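(* Let $N\ge2$, $m=N-1$, $0<g_1<\cdots<g_N$, and let $R=\prod_{j=1}^m[a_j,b_j]$ with $g_j<a_j\le b_j<g_{j+1}$. For $i\in\{1,\dots,m\}$, $k\in[a_i,b_i]$ and $z\in R$ let $$\Phi_{i,k}(z)=(-1)^{i-1}\int_k^{z_i}(z_i-\sigma)\prod_{j\ne i}(z_j-\sigma)\,d\sigma,\qquad \Phi_{i,k}^+=\mathbf 1_{\{z_i>k\}}\Phi_{i,k},\quad \Phi_{i,k}^-=\mathbf 1_{\{z_i<k\}}\Phi_{i,k}.$$ There are constants $0<c_R\le C_R<\infty$, depending only on $R$, $g$ and $N$, such that, with $r=(z_i-k)_+$ for the upper truncation and $r=(k-z_i)_+$ for the lower truncation, one has on the corresponding active side ($\{z_i>k\}$, respectively $\{z_i<k\}$) $$c_Rr^2\le\Phi_{i,k}^\pm(z)\le C_Rr^2,$$ $$|\partial_i\Phi_{i,k}|\le C_Rr,\qquad|\partial_j\Phi_{i,k}|\le C_Rr^2\quad(j\ne i),$$ $$\partial_{ii}\Phi_{i,k}=\prod_{j\ne i}|z_j-z_i|\ge c_R,\qquad\partial_{jj}\Phi_{i,k}=0\quad(j\ne i),$$ and, for every $\alpha\ne\beta$ in $\{1,\dots,m\}$, $$(z_\beta-z_\alpha)\,\partial_{\alpha\beta}\Phi_{i,k}=\partial_\alpha\Phi_{i,k}-\partial_\beta\Phi_{i,k}.$$ Consequently, for a weakly differentiable field $z$ on $\Omega\subset\mathbb R^d$ with values in $R$, $$\mathfrak Q_{\Phi_{i,k}^\pm}(z;\nabla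 z)=\mathfrak a_i(z)\,\partial_{ii}\Phi_{i,k}(z)\,|\nabla r|^2\ge c_R|\nabla r|^2$$ almost everywhere.
   Context: Derivatives $\partial_j$ are with respect to $z_j$. $\lambda_j(z)=\sum_{l=1}^Ng_l-\sum_{\ell\ne j}z_\ell>0$ and $\mathfrak a_j=1/\lambda_j$ on $R$. For a state function $\Psi$ with (weak) second derivatives and $\Xi=(\Xi_1,\dots,\Xi_m)$, $\Xi_j\in\mathbb R^d$, $$\mathfrak Q_\Psi(z;\Xi)=\sum_{j=1}^m\mathfrak a_j\Psi_{jj}|\Xi_j|^2+\sum_{1\le j<k\le m}(\mathfrak a_j+\mathfrak a_k)\Bigl(\Psi_{jk}+\frac{\Psi_j-\Psi_k}{z_j-z_k}\Bigr)\Xi_j\cdot\Xi_k .$$ The functions $\Phi^\pm_{i,k}$ are $C^{1,1}$ on $R$; their weak Hessian is $D^2\Phi_{i,k}$ on the active side and $0$ elsewhere (including, by convention, on $\{z_i=k\}$), and this representative is used in $\mathfrak Q_{\Phi^\pm_{i,k}}$. *)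

theory Defs
  imports "HOL-Analysis.Analysis"
begin

text \<open>
  A state \<open>z = (z\<^sub>1, \<dots>, z\<^sub>m)\<close> is a function \<open>nat \<Rightarrow> real\<close> of which only the values at
  \<open>1, \<dots>, m\<close> are used; throughout \<open>m = N - 1\<close>.
\<close>

definition state_box :: "nat \<Rightarrow> (nat \<Rightarrow> real) \<Rightarrow> (nat \<Rightarrow> real) \<Rightarrow> (nat \<Rightarrow> real) set" where
  "state_box m a b = Pi {1..m} (\<lambda>j. {a j..b j})"

definition partial :: "nat \<Rightarrow> ((nat \<Rightarrow> real) \<Rightarrow> real) \<Rightarrow> (nat \<Rightarrow> real) \<Rightarrow> real" where
  "partial j F z = deriv (\<lambda>t. F (z(j := t))) (z j)"

definition partial2 :: "nat \<Rightarrow> nat \<Rightarrow> ((nat \<Rightarrow> real) \<Rightarrow> real) \<Rightarrow> (nat \<Rightarrow> real) \<Rightarrow> real" where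
  "partial2 j l F = partial j (partial l F)"

definition lam :: "nat \<Rightarrow> (nat \<Rightarrow> real) \<Rightarrow> nat \<Rightarrow> (nat \<Rightarrow> real) \<Rightarrow> real" where
  "lam N g j z = (\<Sum>l = 1..N. g l) - (\<Sum>l \<in> {1..N - 1} - {j}. z l)"

definition acoef :: "nat \<Rightarrow> (nat \<Rightarrow> real) \<Rightarrow> nat \<Rightarrow> (nat \<Rightarrow> real) \<Rightarrow> real" where
  "acoef N g j z = 1 / lam N g j z"

text \<open>
  The integral is oriented: for \<open>z i < k\<close> it is minus the integral over \<open>[z i, k]\<close>.
  The formula makes sense for every \<open>z\<close>, not only in the box, and partial derivatives
  are those of this polynomial in \<open>z\<close>; this also gives them a meaning on the boundary of the box and
  when some of its edges degenerate to a point.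
\<close>

definition Phi :: "nat \<Rightarrow> nat \<Rightarrow> real \<Rightarrow> (nat \<Rightarrow> real) \<Rightarrow> real" where
  "Phi m i k z = (-1) ^ (i - 1) *
     (LBINT s=ereal k..ereal (z i). (z i - s) * (\<Prod>j \<in> {1..m} - {i}. z j - s))"

text \<open>
  \<open>Upper\<close> stands for the truncation to \<open>z i > k\<close> (superscript plus), \<open>Lower\<close> for
  the truncation to \<open>z i < k\<close> (superscript minus).
\<close>

datatype side = Upper | Lower

fun active :: "side \<Rightarrow> real \<Rightarrow> real \<Rightarrow> bool" where
  "active Upper k t \<longleftrightarrow> k < t"
| "active Lower k t \<longleftrightarrow> t < k"

fun excess :: "side \<Rightarrow> real \<Rightarrow> real \<Rightarrow> real" where
  "excess Upper k t = max (t - k) 0"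
| "excess Lower k t = max (k - t) 0"

definition Phi_trunc :: "side \<Rightarrow> nat \<Rightarrow> nat \<Rightarrow> real \<Rightarrow> (nat \<Rightarrow> real) \<Rightarrow> real" where
  "Phi_trunc s m i k z = (if active s k (z i) then Phi m i k z else 0)"

text \<open>
  The weak Hessian of a truncation is defined only up to null sets. The representative fixed
  here is zero off the active side, including on \<open>z i = k\<close>.
\<close>

definition Phi_trunc_hess ::
    "side \<Rightarrow> nat \<Rightarrow> nat \<Rightarrow> real \<Rightarrow> nat \<Rightarrow> nat \<Rightarrow> (nat \<Rightarrow> real) \<Rightarrow> real" where
  "Phi_trunc_hess s m i k j l z = (if active s k (z i) then partial2 j l (Phi m i k) z else 0)"

text \<open>
  \<open>Q_form N g \<Psi> H z \<Xi>\<close> is the quadratic form of the state function \<open>\<Psi>\<close>, where \<open>H\<close> is the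
  chosen representative of its weak Hessian.
\<close>

definition Q_form ::
    "nat \<Rightarrow> (nat \<Rightarrow> real) \<Rightarrow> ((nat \<Rightarrow> real) \<Rightarrow> real) \<Rightarrow> (nat \<Rightarrow> nat \<Rightarrow> (nat \<Rightarrow> real) \<Rightarrow> real)
      \<Rightarrow> (nat \<Rightarrow> real) \<Rightarrow> (nat \<Rightarrow> 'd::euclidean_space) \<Rightarrow> real" where
  "Q_form N g \<Psi> H z \<Xi> =
     (\<Sum>j = 1..N - 1. acoef N g j z * H j j z * (norm (\<Xi> j))\<^sup>2)
   + (\<Sum>(j, l) \<in> {(j, l). 1 \<le> j \<and> j < l \<and> l \<le> N - 1}.
        (acoef N g j z + acoef N g l z)
        * (H j l z + (partial j \<Psi> z - partial l \<Psi> z) / (z j - z l))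
        * (\<Xi> j \<bullet> \<Xi> l))"

definition Q_Phi_trunc ::
    "side \<Rightarrow> nat \<Rightarrow> (nat \<Rightarrow> real) \<Rightarrow> nat \<Rightarrow> real
      \<Rightarrow> (nat \<Rightarrow> real) \<Rightarrow> (nat \<Rightarrow> 'd::euclidean_space) \<Rightarrow> real" where
  "Q_Phi_trunc s N g i k =
     Q_form N g (Phi_trunc s (N - 1) i k) (Phi_trunc_hess s (N - 1) i k)"

text \<open>
  The constants \<open>c\<close> and \<open>C\<close> realise all pointwise estimates on the active sides. The last
  conjunct is the pointwise form of the coercivity of \<open>Q_Phi_trunc\<close>. It is included so that the
  constants can be chosen before the dimension of the domain of a field, which is a type.
\<close>

definition truncation_constants ::
    "nat \<Rightarrow> (nat \<Rightarrow> real) \<Rightarrow> (nat \<Rightarrow> real) \<Rightarrow> (nat \<Rightarrow> real) \<Rightarrow> real \<Rightarrow> real \<Rightarrow> bool" where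
  "truncation_constants N g a b c C \<longleftrightarrow>
     0 < c \<and> c \<le> C \<and>
     (\<forall>s. \<forall>i \<in> {1..N - 1}. \<forall>k \<in> {a i..b i}. \<forall>z \<in> state_box (N - 1) a b. active s k (z i) \<longrightarrow>
        (let r = excess s k (z i); \<Phi> = Phi (N - 1) i k in
          c * r\<^sup>2 \<le> Phi_trunc s (N - 1) i k z \<and> Phi_trunc s (N - 1) i k z \<le> C * r\<^sup>2
        \<and> \<bar>partial i \<Phi> z\<bar> \<le> C * r
        \<and> (\<forall>j \<in> {1..N - 1} - {i}. \<bar>partial j \<Phi> z\<bar> \<le> C * r\<^sup>2)
        \<and> partial2 i i \<Phi> z = (\<Prod>j \<in> {1..N - 1} - {i}. \<bar>z j - z i\<bar>)
        \<and> c \<le> partial2 i i \<Phi> z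
        \<and> (\<forall>j \<in> {1..N - 1} - {i}. partial2 j j \<Phi> z = 0)
        \<and> (\<forall>\<alpha> \<in> {1..N - 1}. \<forall>\<beta> \<in> {1..N - 1}. \<alpha> \<noteq> \<beta> \<longrightarrow>
             (z \<beta> - z \<alpha>) * partial2 \<alpha> \<beta> \<Phi> z = partial \<alpha> \<Phi> z - partial \<beta> \<Phi> z)
        \<and> c \<le> acoef N g i z * partial2 i i \<Phi> z))"

text \<open>
  Weak differentiability in the sense of Gilbarg and Trudinger: locally integrable weak
  derivatives of first order, tested against continuously differentiable functions with compact
  support in the open set \<open>\<Omega>\<close>.
\<close>

definition locally_integrable_on ::
    "('d::euclidean_space \<Rightarrow> 'e::euclidean_space) \<Rightarrow> 'd set \<Rightarrow> bool"
    (infixr "locally'_integrable'_on" 46) where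
  "u locally_integrable_on \<Omega> \<longleftrightarrow> (\<forall>K. compact K \<and> K \<subseteq> \<Omega> \<longrightarrow> u absolutely_integrable_on K)"

definition test_function ::
    "'d::euclidean_space set \<Rightarrow> ('d \<Rightarrow> real) \<Rightarrow> ('d \<Rightarrow> 'd) \<Rightarrow> bool" where
  "test_function \<Omega> \<phi> D\<phi> \<longleftrightarrow>
     (\<forall>x. GDERIV \<phi> x :> D\<phi> x) \<and> continuous_on UNIV D\<phi> \<and>
     (\<exists>K. compact K \<and> K \<subseteq> \<Omega> \<and> (\<forall>x. x \<notin> K \<longrightarrow> \<phi> x = 0))"

definition has_weak_gradient ::
    "'d::euclidean_space set \<Rightarrow> ('d \<Rightarrow> real) \<Rightarrow> ('d \<Rightarrow> 'd) \<Rightarrow> bool" where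
  "has_weak_gradient \<Omega> u G \<longleftrightarrow>
     u locally_integrable_on \<Omega> \<and> G locally_integrable_on \<Omega> \<and>
     (\<forall>\<phi> D\<phi>. test_function \<Omega> \<phi> D\<phi> \<longrightarrow>
        (LINT x:\<Omega>|lebesgue. u x *\<^sub>R D\<phi> x) = - (LINT x:\<Omega>|lebesgue. \<phi> x *\<^sub>R G x))"

end

(*
  With node polynomials prod_{j in A} (z_j - s) in place of Phi, differentiating in z_j just deletes
  the node j (the boundary term at s = z_i vanishes as long as the node i is present), which
  yields all derivative formulas and the mixed-derivative identity; that identity cancels every
  off-diagonal term of the quadratic form.  The truncation r = (z_i - k)_+ is handled without
  mollification.  Translation continuity in L^1 upgrades the weak derivative p of u to weak convergence of
  difference quotients, tested even against discontinuous functions 1_A phi.  Since the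
  truncation E is convex, E(y) - E(x) >= E'(x) (y - x), and integrating this against a nonnegative
  test function with steps t > 0 and t < 0 gives both inequalities of the chain rule, with
  the one-sided choice E'(k) = 0 at the kink.
*)
theory Submission
  imports Defs
begin

subsection \<open>Test functions\<close>

text \<open>The weak gradient is given by Lebesgue integrals over \<open>\<Omega>\<close> of locally
  integrable functions, while translations act on integrable Borel functions on the whole space. So
  every argument is localised: \<open>u\<close> and the components of \<open>G\<close> are replaced
  on a compact \<open>C\<close> by Borel representatives vanishing off \<open>C\<close>, and the
  weak identity survives for test functions supported in \<open>interior C\<close>, one direction at
  a time. The obstacle is that the slope of the truncation, as a function of the point, is a
  multiple of the discontinuous indicator of the active set. Weak convergence against it rests on an
  estimate of the increment of \<open>u\<close> whose constant contains the supremum of the test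
  function but not that of its gradient. The final statement concerns every weak gradient
  \<open>Dr\<close> of the truncation, so uniqueness of weak gradients is proved as well. Slope 0 at
  the kink matches the convention that the Hessian is 0 on \<open>z i = k\<close>; hence no argument
  about gradients on level sets enters. The constants come from the numbers \<open>g j\<close>,
  which separate the edges of the box and keep distinct nodes at distance at least
  \<open>gap\<close>.\<close>

lemma test_functionE:
  assumes "test_function V \<phi> D\<phi>"
  obtains K where "compact K" "K \<subseteq> V" "\<And>x. x \<notin> K \<Longrightarrow> \<phi> x = 0" "\<And>x. x \<notin> K \<Longrightarrow> D\<phi> x = 0"
    "\<And>x. GDERIV \<phi> x :> D\<phi> x" "continuous_on UNIV D\<phi>" "continuous_on UNIV \<phi>"
proof -
  obtain K where K: "compact K" "K \<subseteq> V" "\<And>x. x \<notin> K \<Longrightarrow> \<phi> x = 0"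
    and D: "\<And>x. GDERIV \<phi> x :> D\<phi> x" "continuous_on UNIV D\<phi>"
    using assms unfolding test_function_def by metis
  \<comment> \<open>The definition makes only \<open>\<phi>\<close> vanish off \<open>K\<close>. The
    complement of \<open>K\<close> is open, so \<open>\<phi>\<close> is locally constant there and
    its gradient vanishes too.\<close>
  have "D\<phi> x = 0" if "x \<notin> K" for x
  proof -
    have "((\<lambda>_. 0) has_derivative (\<lambda>_. 0)) (at x)" by simp
    then have "(\<phi> has_derivative (\<lambda>_. 0)) (at x)"
      by (rule has_derivative_transform_within_open[of _ _ _ _ "- K"])
        (use K that in \<open>auto simp: compact_imp_closed open_Compl\<close>)
    moreover have "(\<phi> has_derivative (\<lambda>h. h \<bullet> D\<phi> x)) (at x)"
      using D(1)[of x] by (simp add: gderiv_def)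
    ultimately have "(\<lambda>_. 0) = (\<lambda>h. h \<bullet> D\<phi> x)"
      by (rule has_derivative_unique)
    then have "D\<phi> x \<bullet> D\<phi> x = 0" by metis
    then show ?thesis by simp
  qed
  moreover have "continuous_on UNIV \<phi>"
    by (metis D(1) continuous_at_imp_continuous_on gderiv_def has_derivative_continuous)
  ultimately show thesis using that K D by blast
qed

lemma test_function_mono:
  "test_function V \<phi> D\<phi> \<Longrightarrow> V \<subseteq> W \<Longrightarrow> test_function W \<phi> D\<phi>"
  unfolding test_function_def by blast

lemma test_function_add:
  assumes "test_function V \<phi> D\<phi>" "test_function V \<psi> D\<psi>"
  shows "test_function V (\<lambda>x. \<phi> x + \<psi> x) (\<lambda>x. D\<phi> x + D\<psi> x)"
proof -
  obtain K L where "compact K" "K \<subseteq> V" "\<forall>x. x \<notin> K \<longrightarrow> \<phi> x = 0" "compact L" "L \<subseteq> V" "\<forall>x. x \<notin> L \<longrightarrow> \<psi> x = 0"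
    using assms unfolding test_function_def by metis
  then have "\<exists>K. compact K \<and> K \<subseteq> V \<and> (\<forall>x. x \<notin> K \<longrightarrow> \<phi> x + \<psi> x = 0)"
    by (intro exI[of _ "K \<union> L"]) auto
  then show ?thesis
    using assms unfolding test_function_def by (auto intro!: GDERIV_add continuous_intros)
qed

lemma test_function_mult_support:
  assumes "test_function V \<phi> D\<phi>" "compact K" "K \<subseteq> V" "\<And>x. x \<notin> K \<Longrightarrow> \<phi> x = 0"
    and "test_function W \<psi> D\<psi>"
  shows "test_function V (\<lambda>x. \<phi> x * \<psi> x) (\<lambda>x. \<phi> x *\<^sub>R D\<psi> x + \<psi> x *\<^sub>R D\<phi> x)"
proof -
  have "continuous_on UNIV \<phi>" "continuous_on UNIV \<psi>"
    using assms(1,5) by (meson test_functionE)+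
  then show ?thesis
    using assms unfolding test_function_def
    by (auto intro!: GDERIV_mult continuous_intros exI[of _ K])
qed

lemma test_function_mult:
  assumes "test_function V \<phi> D\<phi>" "test_function W \<psi> D\<psi>"
  shows "test_function V (\<lambda>x. \<phi> x * \<psi> x) (\<lambda>x. \<phi> x *\<^sub>R D\<psi> x + \<psi> x *\<^sub>R D\<phi> x)"
  using test_functionE[OF assms(1)] test_function_mult_support[OF assms(1) _ _ _ assms(2)] by metis

text \<open>\<open>f 0 = 0\<close> preserves the support. Regularity of \<open>f\<close> is demanded
  on the range of \<open>\<phi>\<close> because the cutoff below composes with a rational function
  that has a pole at a negative argument.\<close>

lemma test_function_compose:
  assumes \<phi>: "test_function V \<phi> D\<phi>" and "f 0 = 0"
    and f: "\<And>x. (f has_real_derivative f' (\<phi> x)) (at (\<phi> x))"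
    and f': "continuous_on (range \<phi>) f'"
  shows "test_function V (\<lambda>x. f (\<phi> x)) (\<lambda>x. f' (\<phi> x) *\<^sub>R D\<phi> x)"
proof -
  have "continuous_on UNIV \<phi>" using \<phi> by (meson test_functionE)
  moreover from this have "continuous_on UNIV (\<lambda>x. f' (\<phi> x))"
    using continuous_on_compose2[OF f'] by blast
  moreover have "continuous_on UNIV D\<phi>" "\<And>x. GDERIV \<phi> x :> D\<phi> x"
    using \<phi> by (auto simp: test_function_def)
  moreover obtain K where "compact K" "K \<subseteq> V" "\<And>x. x \<notin> K \<Longrightarrow> f (\<phi> x) = 0"
    using \<phi> \<open>f 0 = 0\<close> unfolding test_function_def by metis
  ultimately show ?thesis
    unfolding test_function_def
    by (intro conjI allI exI[of _ K] continuous_on_scaleR GDERIV_DERIV_compose f) auto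
qed

lemma test_function_cmult:
  "test_function V \<phi> D\<phi> \<Longrightarrow> test_function V (\<lambda>x. c * \<phi> x) (\<lambda>x. c *\<^sub>R D\<phi> x)"
  by (rule test_function_compose[where f = "\<lambda>t. c * t" and f' = "\<lambda>_. c"])
    (auto intro!: derivative_eq_intros)

lemma test_function_sum:
  assumes "finite I" "\<And>i. i \<in> I \<Longrightarrow> test_function V (\<phi> i) (D\<phi> i)"
  shows "test_function V (\<lambda>x. \<Sum>i\<in>I. \<phi> i x) (\<lambda>x. \<Sum>i\<in>I. D\<phi> i x)"
  using assms
proof (induction I rule: finite_induct)
  case empty
  then show ?case
    by (auto simp: test_function_def GDERIV_const intro!: exI[of _ "{}"])
next
  case (insert i I)
  then show ?case by (simp add: test_function_add)
qed

section \<open>Bumps, cutoffs, and approximation of indicators by test functions\<close>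

lemma has_real_derivative_pos_part_square:
  "((\<lambda>t::real. (max 0 t)\<^sup>2) has_real_derivative 2 * max 0 t) (at t)"
proof (cases t "0::real" rule: linorder_cases)
  case less
  have "((\<lambda>_::real. 0) has_real_derivative 0) (at t)" by simp
  then have "((\<lambda>t::real. (max 0 t)\<^sup>2) has_real_derivative 0) (at t)"
    by (rule has_field_derivative_transform_within_open[of _ _ _ "{..<0}"]) (use less in auto)
  then show ?thesis using less by simp
next
  case greater
  have "((\<lambda>t::real. t\<^sup>2) has_real_derivative 2 * t) (at t)" by (auto intro!: derivative_eq_intros)
  then have "((\<lambda>t::real. (max 0 t)\<^sup>2) has_real_derivative 2 * t) (at t)"
    by (rule has_field_derivative_transform_within_open[of _ _ _ "{0<..}"]) (use greater in auto)
  then show ?thesis using greater by simp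
next
  case equal
  have "((\<lambda>h::real. (max 0 h)\<^sup>2 / h) \<longlongrightarrow> 0) (at 0)"
  proof (rule Lim_null_comparison)
    show "\<forall>\<^sub>F h::real in at 0. norm ((max 0 h)\<^sup>2 / h) \<le> \<bar>h\<bar>"
      by (intro always_eventually allI) (auto simp: max_def power2_eq_square)
    show "((\<lambda>h::real. \<bar>h\<bar>) \<longlongrightarrow> 0) (at 0)"
      by (auto intro!: tendsto_eq_intros)
  qed
  then show ?thesis using equal by (simp add: DERIV_def)
qed

text \<open>Test functions are only once continuously differentiable, so the squared positive part
  of \<open>r\<^sup>2 - (norm (x - c))\<^sup>2\<close> is smooth enough and can be differentiated
  explicitly.\<close>

lemma test_function_bump:
  assumes "0 \<le> r" "cball c r \<subseteq> V"
  shows "test_function V (\<lambda>x. (max 0 (r\<^sup>2 - (x - c) \<bullet> (x - c)))\<^sup>2)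
           (\<lambda>x. (2 * max 0 (r\<^sup>2 - (x - c) \<bullet> (x - c))) *\<^sub>R (- 2 *\<^sub>R (x - c)))"
proof -
  have "GDERIV (\<lambda>x. r\<^sup>2 - (x - c) \<bullet> (x - c)) x :> - 2 *\<^sub>R (x - c)" for x
    unfolding gderiv_def by (auto intro!: derivative_eq_intros simp: algebra_simps inner_commute)
  then have "GDERIV (\<lambda>x. (max 0 (r\<^sup>2 - (x - c) \<bullet> (x - c)))\<^sup>2) x
      :> (2 * max 0 (r\<^sup>2 - (x - c) \<bullet> (x - c))) *\<^sub>R (- 2 *\<^sub>R (x - c))" for x
    by (rule GDERIV_DERIV_compose[OF _ has_real_derivative_pos_part_square])
  moreover have "(max 0 (r\<^sup>2 - (x - c) \<bullet> (x - c)))\<^sup>2 = 0" if "x \<notin> cball c r" for x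
  proof -
    have "r\<^sup>2 \<le> (norm (x - c))\<^sup>2"
      using that \<open>0 \<le> r\<close> by (intro power_mono) (auto simp: dist_norm norm_minus_commute)
    then show ?thesis by (simp add: power2_norm_eq_inner)
  qed
  moreover have "continuous_on UNIV (\<lambda>x. (2 * max 0 (r\<^sup>2 - (x - c) \<bullet> (x - c))) *\<^sub>R (- 2 *\<^sub>R (x - c)))"
    by (intro continuous_intros)
  ultimately show ?thesis
    using assms unfolding test_function_def by (metis compact_cball)
qed

text \<open>Finitely many balls cover \<open>K\<close>, and the sum of their bumps is positive on
  it.\<close>

lemma compact_positive_test_function:
  assumes "compact K" "open V" "K \<subseteq> V"
  obtains \<phi> D\<phi> where "test_function V \<phi> D\<phi>" "\<And>x. 0 \<le> \<phi> x" "\<And>x. x \<in> K \<Longrightarrow> 0 < \<phi> x"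
proof -
  define q where "q = (\<lambda>r (c::'a) x. (max 0 (r\<^sup>2 - (x - c) \<bullet> (x - c)))\<^sup>2)"
  define Dq where "Dq = (\<lambda>r (c::'a) x. (2 * max 0 (r\<^sup>2 - (x - c) \<bullet> (x - c))) *\<^sub>R (- 2 *\<^sub>R (x - c)))"
  have q0: "0 \<le> q r c x" for r c x by (simp add: q_def)
  have qpos: "0 < q r c x" if "x \<in> ball c r" for r c x
  proof -
    have "(norm (x - c))\<^sup>2 < r\<^sup>2"
      using that by (intro power_strict_mono) (auto simp: dist_norm norm_minus_commute)
    then show ?thesis by (simp add: q_def power2_norm_eq_inner)
  qed
  have "\<exists>r>0. cball x r \<subseteq> V" if "x \<in> K" for x
    using assms that open_contains_cball by blast
  then obtain r where r: "\<And>x. x \<in> K \<Longrightarrow> 0 < r x \<and> cball x (r x) \<subseteq> V" by metis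
  obtain F where F: "F \<subseteq> K" "finite F" "K \<subseteq> (\<Union>c\<in>F. ball c (r c))"
    by (rule compactE_image[OF \<open>compact K\<close>, of K "\<lambda>x. ball x (r x)"]) (use r in auto)
  show thesis
  proof
    show "test_function V (\<lambda>x. \<Sum>c\<in>F. q (r c) c x) (\<lambda>x. \<Sum>c\<in>F. Dq (r c) c x)"
      unfolding q_def Dq_def using F r by (intro test_function_sum test_function_bump) force+
    show "0 \<le> (\<Sum>c\<in>F. q (r c) c x)" for x using q0 by (simp add: sum_nonneg)
    show "0 < (\<Sum>c\<in>F. q (r c) c x)" if x: "x \<in> K" for x
    proof -
      obtain c where "c \<in> F" "x \<in> ball c (r c)" using F(3) x by blast
      then show ?thesis
        using q0 qpos[of x c "r c"] by (intro sum_pos2[OF F(2), of c]) auto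
    qed
  qed
qed

text \<open>A positive function \<open>p\<close> is flattened by \<open>n * p / (1 + n * p)\<close>,
  which stays below 1 and tends to 1 uniformly on \<open>K\<close> as \<open>n\<close> grows. Being
  close to 1 on \<open>K\<close>, rather than equal to 1, suffices for all later uses.\<close>

lemma compact_cutoff:
  fixes e :: real
  assumes "compact K" "open V" "K \<subseteq> V" "0 < e"
  obtains \<phi> D\<phi> where "test_function V \<phi> D\<phi>" "\<And>x. 0 \<le> \<phi> x" "\<And>x. \<phi> x \<le> 1"
    "\<And>x. x \<in> K \<Longrightarrow> 1 - e < \<phi> x"
proof -
  obtain p Dp where p: "test_function V p Dp" "\<And>x. 0 \<le> p x" "\<And>x. x \<in> K \<Longrightarrow> 0 < p x"
    using compact_positive_test_function[OF assms(1-3)] by metis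
  have "\<exists>d>0. \<forall>x\<in>K. d \<le> p x"
  proof (cases "K = {}")
    case False
    have "continuous_on K p"
      using p(1) by (meson test_functionE continuous_on_subset subset_UNIV)
    then obtain x where "x \<in> K" "\<forall>y\<in>K. p x \<le> p y"
      using continuous_attains_inf[OF \<open>compact K\<close> False] by blast
    then show ?thesis using p(3) by blast
  qed (auto intro: exI[of _ 1])
  then obtain d where d: "0 < d" "\<And>x. x \<in> K \<Longrightarrow> d \<le> p x" by blast
  \<comment> \<open>On \<open>K\<close> this gives \<open>n * p x \<ge> 1 / e\<close>, so the defect
    \<open>1 / (1 + n * p x)\<close> is below \<open>e\<close>.\<close>
  define n where "n = 1 / (d * e)"
  have n: "0 < n" using d assms by (simp add: n_def)
  have pos: "1 + n * p x > 0" for x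
    using n p(2)[of x] by (simp add: add_pos_nonneg)
  show thesis
  proof
    show "test_function V (\<lambda>x. n * p x / (1 + n * p x)) (\<lambda>x. (n / (1 + n * p x)\<^sup>2) *\<^sub>R Dp x)"
    proof (rule test_function_compose[OF p(1), of "\<lambda>t. n * t / (1 + n * t)" "\<lambda>t. n / (1 + n * t)\<^sup>2"])
      show "((\<lambda>t. n * t / (1 + n * t)) has_real_derivative n / (1 + n * p x)\<^sup>2) (at (p x))" for x
        using pos[of x] by (auto intro!: derivative_eq_intros simp: field_simps power2_eq_square)
      show "continuous_on (range p) (\<lambda>t. n / (1 + n * t)\<^sup>2)"
        using pos by (intro continuous_intros) (auto simp: less_imp_neq[symmetric])
    qed auto
    show "0 \<le> n * p x / (1 + n * p x)" "n * p x / (1 + n * p x) \<le> 1" for x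
      using pos[of x] n p(2)[of x] by (auto simp: divide_simps)
    show "1 - e < n * p x / (1 + n * p x)" if "x \<in> K" for x
    proof -
      have "1 \<le> n * p x * e"
        using d(2)[OF that] d(1) \<open>0 < e\<close> by (simp add: n_def divide_simps)
      then show ?thesis
        using pos[of x] \<open>0 < e\<close> by (simp add: divide_simps) (simp add: algebra_simps)
    qed
  qed
qed

lemma test_function_borel_measurable [measurable]:
  "test_function V \<phi> D\<phi> \<Longrightarrow> \<phi> \<in> borel_measurable borel"
  by (meson test_functionE borel_measurable_continuous_onI)

lemma integrable_mult_continuous_compact_support:
  fixes \<phi> f :: "'d::euclidean_space \<Rightarrow> real"
  assumes \<phi>: "continuous_on UNIV \<phi>" "compact K" "\<And>x. x \<notin> K \<Longrightarrow> \<phi> x = 0" and f: "integrable lborel f"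
  shows "integrable lborel (\<lambda>x. \<phi> x * f x)"
proof -
  have "bounded (\<phi> ` K)"
    using \<phi> by (intro compact_imp_bounded compact_continuous_image) (auto intro: continuous_on_subset)
  then obtain B where B: "\<And>x. x \<in> K \<Longrightarrow> \<bar>\<phi> x\<bar> \<le> B" unfolding bounded_iff by auto
  have [measurable]: "\<phi> \<in> borel_measurable borel" using \<phi>(1) by (rule borel_measurable_continuous_onI)
  have "\<bar>\<phi> x\<bar> \<le> \<bar>B\<bar>" for x using B[of x] \<phi>(3)[of x] by (cases "x \<in> K") auto
  then show ?thesis
    by (intro Bochner_Integration.integrable_bound[OF integrable_mult_right[OF f, of "\<bar>B\<bar>"]])
      (use f in \<open>auto simp: abs_mult intro!: mult_right_mono\<close>)
qed

text \<open>By regularity of Lebesgue measure \<open>A\<close> lies between a compact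
  \<open>C\<close> and an open \<open>T\<close> of nearly the same measure. A cutoff that is almost
  1 on \<open>C\<close> and vanishes off \<open>T\<close> errs by at most \<open>d\<close> on
  \<open>C\<close> and by at most 1 on the two thin layers.\<close>

lemma borel_indicator_approx_test_function:
  fixes A :: "'d::euclidean_space set"
  assumes A: "A \<in> sets borel" and K: "compact K" "A \<subseteq> K" and V: "open V" "K \<subseteq> V" and e: "0 < (e::real)"
  obtains \<phi> D\<phi> where "test_function V \<phi> D\<phi>" "\<And>x. 0 \<le> \<phi> x" "\<And>x. \<phi> x \<le> 1"
    "integrable lborel (\<lambda>x. \<phi> x - indicator A x)" "(\<integral>x. \<bar>\<phi> x - indicator A x\<bar> \<partial>lborel) < e"
proof -
  have AL: "A \<in> sets lebesgue" using A by simp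
  have fK: "emeasure lborel K < \<infinity>" using K emeasure_compact_finite by blast
  have fA: "emeasure lborel A < \<infinity>"
    using emeasure_mono[of A K lborel] K fK by (auto simp: borel_compact order.strict_trans1 top.not_eq_extremum)
  have "0 < e / 3" using e by simp
  obtain T where T: "open T" "A \<subseteq> T" "emeasure lebesgue (T - A) < ennreal (e / 3)"
    using sets_lebesgue_outer_open[OF AL \<open>0 < e / 3\<close>] by metis
  obtain C where C: "closed C" "C \<subseteq> A" "emeasure lebesgue (A - C) < ennreal (e / 3)"
    using sets_lebesgue_inner_closed[OF AL \<open>0 < e / 3\<close>] by metis
  have cC: "compact C" using C K by (metis bounded_subset compact_eq_bounded_closed subset_trans)
  have [measurable]: "T \<in> sets borel" "C \<in> sets borel" "A \<in> sets borel" using T C A by auto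
  have TA: "emeasure lborel (T - A) < ennreal (e / 3)" and AC: "emeasure lborel (A - C) < ennreal (e / 3)"
    using T C by simp_all
  define \<mu> where "\<mu> = measure lborel A"
  have \<mu>: "0 \<le> \<mu>" by (simp add: \<mu>_def)
  \<comment> \<open>A third of \<open>e\<close> is reserved for the error on \<open>C\<close> and
    for each layer; the summand 1 covers \<open>\<mu> = 0\<close>.\<close>
  define d where "d = e / (3 * (\<mu> + 1))"
  have d: "0 < d" using e \<mu> by (simp add: d_def)
  have CTV: "C \<subseteq> T \<inter> V" using C T K V by blast
  obtain \<phi> D\<phi> where \<phi>: "test_function (T \<inter> V) \<phi> D\<phi>" "\<And>x. 0 \<le> \<phi> x" "\<And>x. \<phi> x \<le> 1"
    "\<And>x. x \<in> C \<Longrightarrow> 1 - d < \<phi> x"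
    using compact_cutoff[OF cC open_Int[OF T(1) V(1)] CTV d] by metis
  have \<phi>T: "\<phi> x = 0" if "x \<notin> T" for x
    using \<phi>(1) that unfolding test_function_def by blast
  have [measurable]: "\<phi> \<in> borel_measurable borel" using \<phi>(1) by (rule test_function_borel_measurable)
  let ?g = "\<lambda>x. d * indicator A x + indicator (T - A) x + indicator (A - C) x :: real"
  have le: "\<bar>\<phi> x - indicator A x\<bar> \<le> ?g x" for x
    using \<phi>(2)[of x] \<phi>(3)[of x] \<phi>(4)[of x] \<phi>T[of x] C(2) T(2) d
    by (cases "x \<in> C"; cases "x \<in> A"; cases "x \<in> T") (auto simp: indicator_def)
  have ii: "integrable lborel (indicator A :: _ \<Rightarrow> real)"
      "integrable lborel (indicator (T - A) :: _ \<Rightarrow> real)"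
      "integrable lborel (indicator (A - C) :: _ \<Rightarrow> real)"
    using fA TA AC by (auto intro!: integrable_real_indicator elim: order.strict_trans)
  have ig: "integrable lborel ?g" using ii by auto
  have int: "integrable lborel (\<lambda>x. \<phi> x - indicator A x)"
    by (rule Bochner_Integration.integrable_bound[OF ig]) (auto intro!: AE_I2 order_trans[OF le abs_ge_self])
  have lt: "measure lborel S < e / 3" if "emeasure lborel S < ennreal (e / 3)" for S
  proof -
    have "emeasure lborel S \<noteq> \<infinity>" using that by (auto simp: top_unique)
    then show ?thesis using that e by (simp add: emeasure_eq_ennreal_measure ennreal_less_iff)
  qed
  have m: "measure lborel (T - A) < e / 3" "measure lborel (A - C) < e / 3"
    by (rule lt[OF TA], rule lt[OF AC])
  have "(\<integral>x. \<bar>\<phi> x - indicator A x\<bar> \<partial>lborel) \<le> (\<integral>x. ?g x \<partial>lborel)"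
    by (intro integral_mono le ig integrable_abs int)
  also have "\<dots> = d * \<mu> + measure lborel (T - A) + measure lborel (A - C)"
    using ii by (simp add: \<mu>_def)
  also have "\<dots> < e"
  proof -
    have "d * \<mu> \<le> e / 3" using e \<mu> by (simp add: d_def divide_simps)
    then show ?thesis using m by simp
  qed
  finally show thesis
    using that[OF test_function_mono[OF \<phi>(1)] \<phi>(2,3) int] by blast
qed

text \<open>A subsequence of the approximations in mean converges almost everywhere. Together with
  the bound 1 this allows dominated convergence against any integrable factor, where convergence in
  mean alone would ask for a bounded one.\<close>

lemma borel_indicator_AE_limit_test_functions:
  fixes A :: "'d::euclidean_space set"
  assumes A: "A \<in> sets borel" and K: "compact K" "A \<subseteq> K" and V: "open V" "K \<subseteq> V"
  obtains \<phi> D\<phi> where "\<And>n::nat. test_function V (\<phi> n) (D\<phi> n)" "\<And>n x. 0 \<le> \<phi> n x" "\<And>n x. \<phi> n x \<le> 1"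
    "AE x in lborel. (\<lambda>n. \<phi> n x) \<longlonglongrightarrow> indicator A x"
proof -
  have "\<exists>\<phi> D\<phi>. test_function V \<phi> D\<phi> \<and> (\<forall>x. 0 \<le> \<phi> x \<and> \<phi> x \<le> 1) \<and>
    integrable lborel (\<lambda>x. \<phi> x - indicator A x) \<and> (\<integral>x. \<bar>\<phi> x - indicator A x\<bar> \<partial>lborel) < 1 / Suc n" for n :: nat
    by (rule borel_indicator_approx_test_function[OF assms, of "1 / Suc n"]) auto
  then obtain \<phi> D\<phi> where \<phi>: "\<And>n. test_function V (\<phi> n) (D\<phi> n)" "\<And>n x. 0 \<le> \<phi> n x" "\<And>n x. \<phi> n x \<le> 1"
    "\<And>n. integrable lborel (\<lambda>x. \<phi> n x - indicator A x)" "\<And>n. (\<integral>x. \<bar>\<phi> n x - indicator A x\<bar> \<partial>lborel) < 1 / Suc n"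
    by metis
  have "(\<lambda>n. \<integral>x. norm (\<phi> n x - indicator A x) \<partial>lborel) \<longlonglongrightarrow> 0"
  proof (rule tendsto_sandwich[OF _ _ tendsto_const LIMSEQ_inverse_real_of_nat])
    show "\<forall>\<^sub>F n in sequentially. (\<integral>x. norm (\<phi> n x - indicator A x) \<partial>lborel) \<le> inverse (real (Suc n))"
      using \<phi>(5) by (intro always_eventually allI) (simp add: inverse_eq_divide less_imp_le del: of_nat_Suc)
  qed simp
  from tendsto_L1_AE_subseq[OF \<phi>(4) this]
  obtain r where "AE x in lborel. (\<lambda>n. \<phi> (r n) x - indicator A x) \<longlonglongrightarrow> 0" by blast
  then have "AE x in lborel. (\<lambda>n. \<phi> (r n) x) \<longlonglongrightarrow> indicator A x"
    by (simp add: LIM_zero_iff)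
  then show thesis using that[of "\<lambda>n. \<phi> (r n)" "\<lambda>n. D\<phi> (r n)"] \<phi> by blast
qed

subsection \<open>Continuity of translations in mean\<close>

lemma
  fixes f :: "'d::euclidean_space \<Rightarrow> real"
  shows lborel_integrable_translate: "integrable lborel f \<Longrightarrow> integrable lborel (\<lambda>x. f (x + c))"
    and lborel_integral_translate: "f \<in> borel_measurable borel \<Longrightarrow> (\<integral>x. f (x + c) \<partial>lborel) = (\<integral>x. f x \<partial>lborel)"
proof -
  have c: "(\<lambda>x. f (x + c)) = (\<lambda>x. f (c + x))" by (simp add: add.commute)
  show "integrable lborel (\<lambda>x. f (x + c))" if f: "integrable lborel f"
  proof -
    have "integrable (distr lborel borel ((+) c)) f" using f by (subst lborel_distr_plus)
    then show ?thesis unfolding c by (rule integrable_distr[rotated]) simp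
  qed
  show "(\<integral>x. f (x + c) \<partial>lborel) = (\<integral>x. f x \<partial>lborel)" if f: "f \<in> borel_measurable borel"
  proof -
    have "(\<integral>x. f x \<partial>distr lborel borel ((+) c)) = (\<integral>x. f (c + x) \<partial>lborel)"
      using f by (intro integral_distr) auto
    then show ?thesis unfolding c lborel_distr_plus by simp
  qed
qed

text \<open>Continuity at \<open>h = 0\<close> of the translates of \<open>f\<close> in the mean. An
  integral of a non-integrable function is 0 by default, so the notion is meaningful for integrable
  \<open>f\<close>.\<close>

definition translation_continuous :: "('d::euclidean_space \<Rightarrow> real) \<Rightarrow> bool" where
  "translation_continuous f \<longleftrightarrow>
     (\<forall>e>0. \<exists>d>0. \<forall>h. norm h < d \<longrightarrow> (\<integral>x. \<bar>f (x + h) - f x\<bar> \<partial>lborel) < e)"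

lemma translation_continuous_add:
  assumes "integrable lborel f" "integrable lborel g" "translation_continuous f" "translation_continuous g"
  shows "translation_continuous (\<lambda>x. f x + g x)"
  unfolding translation_continuous_def
proof (intro allI impI)
  fix e :: real assume "0 < e"
  then have "0 < e / 2" by simp
  obtain d1 where d1: "0 < d1" "\<And>h. norm h < d1 \<Longrightarrow> (\<integral>x. \<bar>f (x + h) - f x\<bar> \<partial>lborel) < e / 2"
    using assms(3) \<open>0 < e / 2\<close> unfolding translation_continuous_def by blast
  obtain d2 where d2: "0 < d2" "\<And>h. norm h < d2 \<Longrightarrow> (\<integral>x. \<bar>g (x + h) - g x\<bar> \<partial>lborel) < e / 2"
    using assms(4) \<open>0 < e / 2\<close> unfolding translation_continuous_def by blast
  show "\<exists>d>0. \<forall>h. norm h < d \<longrightarrow> (\<integral>x. \<bar>f (x + h) + g (x + h) - (f x + g x)\<bar> \<partial>lborel) < e"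
  proof (intro exI[of _ "min d1 d2"] conjI allI impI)
    fix h :: 'a assume h: "norm h < min d1 d2"
    note i = lborel_integrable_translate[OF assms(1), of h] lborel_integrable_translate[OF assms(2), of h] assms(1,2)
    have fg: "integrable lborel (\<lambda>x. \<bar>f (x + h) - f x\<bar>)" "integrable lborel (\<lambda>x. \<bar>g (x + h) - g x\<bar>)"
      by (intro integrable_abs Bochner_Integration.integrable_diff i)+
    have "(\<integral>x. \<bar>f (x + h) + g (x + h) - (f x + g x)\<bar> \<partial>lborel)
        \<le> (\<integral>x. \<bar>f (x + h) - f x\<bar> + \<bar>g (x + h) - g x\<bar> \<partial>lborel)"
    proof (rule integral_mono)
      show "integrable lborel (\<lambda>x. \<bar>f (x + h) + g (x + h) - (f x + g x)\<bar>)"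
        by (intro integrable_abs Bochner_Integration.integrable_diff Bochner_Integration.integrable_add i)
    qed (auto intro!: Bochner_Integration.integrable_add fg)
    also have "\<dots> = (\<integral>x. \<bar>f (x + h) - f x\<bar> \<partial>lborel) + (\<integral>x. \<bar>g (x + h) - g x\<bar> \<partial>lborel)"
      by (intro Bochner_Integration.integral_add fg)
    also have "\<dots> < e" using d1(2)[of h] d2(2)[of h] h by simp
    finally show "(\<integral>x. \<bar>f (x + h) + g (x + h) - (f x + g x)\<bar> \<partial>lborel) < e" .
  qed (use d1 d2 in auto)
qed

text \<open>Three-term estimate through \<open>g\<close>; translation invariance gives the shifted
  error \<open>g - f\<close> the same integral as the unshifted one.\<close>

lemma translation_continuous_limit:
  assumes f: "integrable lborel f"
    and g: "\<And>e. 0 < e \<Longrightarrow> \<exists>g. integrable lborel g \<and> translation_continuous g \<and> (\<integral>x. \<bar>g x - f x\<bar> \<partial>lborel) < e"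
  shows "translation_continuous f"
  unfolding translation_continuous_def
proof (intro allI impI)
  fix e :: real assume "0 < e"
  then have e3: "0 < e / 3" by simp
  then obtain g where g: "integrable lborel g" "translation_continuous g" "(\<integral>x. \<bar>g x - f x\<bar> \<partial>lborel) < e / 3"
    using assms(2) by metis
  obtain d where d: "0 < d" "\<And>h. norm h < d \<Longrightarrow> (\<integral>x. \<bar>g (x + h) - g x\<bar> \<partial>lborel) < e / 3"
    using g(2) e3 unfolding translation_continuous_def by blast
  show "\<exists>d>0. \<forall>h. norm h < d \<longrightarrow> (\<integral>x. \<bar>f (x + h) - f x\<bar> \<partial>lborel) < e"
  proof (intro exI[of _ d] conjI allI impI)
    fix h :: 'a assume h: "norm h < d"
    note i = lborel_integrable_translate[OF f, of h] lborel_integrable_translate[OF g(1), of h] f g(1)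
    have m: "(\<lambda>x. \<bar>g x - f x\<bar>) \<in> borel_measurable borel"
      using borel_measurable_integrable[OF f] borel_measurable_integrable[OF g(1)] by simp
    have fg: "integrable lborel (\<lambda>x. \<bar>g (x + h) - f (x + h)\<bar>)" "integrable lborel (\<lambda>x. \<bar>g (x + h) - g x\<bar>)"
        "integrable lborel (\<lambda>x. \<bar>g x - f x\<bar>)"
      by (intro integrable_abs Bochner_Integration.integrable_diff i)+
    have "(\<integral>x. \<bar>f (x + h) - f x\<bar> \<partial>lborel)
        \<le> (\<integral>x. \<bar>g (x + h) - f (x + h)\<bar> + \<bar>g (x + h) - g x\<bar> + \<bar>g x - f x\<bar> \<partial>lborel)"
    proof (rule integral_mono)
      show "integrable lborel (\<lambda>x. \<bar>f (x + h) - f x\<bar>)"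
        by (intro integrable_abs Bochner_Integration.integrable_diff i)
    qed (auto intro!: Bochner_Integration.integrable_add fg)
    also have "\<dots> = (\<integral>x. \<bar>g (x + h) - f (x + h)\<bar> \<partial>lborel) + (\<integral>x. \<bar>g (x + h) - g x\<bar> \<partial>lborel)
        + (\<integral>x. \<bar>g x - f x\<bar> \<partial>lborel)"
      using fg by simp
    also have "\<dots> < e"
      using d(2)[OF h] g(3) lborel_integral_translate[OF m, of h] by simp
    finally show "(\<integral>x. \<bar>f (x + h) - f x\<bar> \<partial>lborel) < e" .
  qed (use d in auto)
qed

lemma test_function_integrable:
  assumes "test_function V \<phi> D\<phi>"
  shows "integrable lborel \<phi>"
proof -
  obtain K where K: "compact K" "\<And>x. x \<notin> K \<Longrightarrow> \<phi> x = 0" "continuous_on UNIV \<phi>"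
    using test_functionE[OF assms] by metis
  have "integrable lborel (indicator K :: _ \<Rightarrow> real)"
    using K(1) emeasure_compact_finite[OF K(1)] by (intro integrable_real_indicator) (auto simp: borel_compact)
  from integrable_mult_continuous_compact_support[OF K(3,1,2) this] show ?thesis
    by (rule back_subst[of "integrable lborel"]) (auto simp: fun_eq_iff indicator_def K(2))
qed

lemma test_function_translation_continuous:
  assumes "test_function V \<phi> D\<phi>"
  shows "translation_continuous \<phi>"
  unfolding translation_continuous_def
proof (intro allI impI)
  fix e :: real assume e: "0 < e"
  obtain K where K: "compact K" "\<And>x. x \<notin> K \<Longrightarrow> \<phi> x = 0" "continuous_on UNIV \<phi>"
    using test_functionE[OF assms] by metis
  obtain R where R: "\<And>x. x \<in> K \<Longrightarrow> norm x \<le> R"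
    using K(1) compact_imp_bounded bounded_iff by metis
  let ?B = "cball 0 (R + 1) :: 'a set"
  define M where "M = measure lborel ?B"
  have M: "0 \<le> M" by (simp add: M_def)
  have "uniformly_continuous_on (cball 0 (R + 2)) \<phi>"
    using K(3) by (intro compact_uniformly_continuous) (auto intro: continuous_on_subset)
  moreover have "0 < e / (M + 1)" using e M by simp
  ultimately obtain d where d: "0 < d" "\<And>x y. x \<in> cball 0 (R + 2) \<Longrightarrow> y \<in> cball 0 (R + 2) \<Longrightarrow> dist y x < d
      \<Longrightarrow> dist (\<phi> y) (\<phi> x) < e / (M + 1)"
    unfolding uniformly_continuous_on_def by metis
  show "\<exists>d>0. \<forall>h. norm h < d \<longrightarrow> (\<integral>x. \<bar>\<phi> (x + h) - \<phi> x\<bar> \<partial>lborel) < e"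
  proof (intro exI[of _ "min 1 d"] conjI allI impI)
    fix h :: 'a assume h: "norm h < min 1 d"
    \<comment> \<open>Shifts shorter than 1 keep the difference supported in \<open>?B\<close>;
      uniform continuity is taken on a ball larger by 1 so that it contains \<open>x + h\<close> as
      well.\<close>
    have le: "\<bar>\<phi> (x + h) - \<phi> x\<bar> \<le> e / (M + 1) * indicator ?B x" for x
    proof (cases "norm x \<le> R + 1")
      case True
      then have "norm (x + h) \<le> R + 2" using h norm_triangle_ineq[of x h] by simp
      then show ?thesis
        using d(2)[of x "x + h"] True h norm_minus_cancel[of "x + h"] by (auto simp: dist_norm less_imp_le)
    next
      case False
      then have "norm (x + h) > R" using h norm_diff_ineq[of x h] by simp
      then show ?thesis using False R[of x] R[of "x + h"] K(2)[of x] K(2)[of "x + h"] by force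
    qed
    note i = test_function_integrable[OF assms] lborel_integrable_translate[OF test_function_integrable[OF assms], of h]
    have iB: "integrable lborel (indicator ?B :: _ \<Rightarrow> real)"
      using emeasure_compact_finite[of ?B] by (intro integrable_real_indicator) auto
    have "(\<integral>x. \<bar>\<phi> (x + h) - \<phi> x\<bar> \<partial>lborel) \<le> (\<integral>x. e / (M + 1) * indicator ?B x \<partial>lborel)"
      by (intro integral_mono le integrable_abs Bochner_Integration.integrable_diff i integrable_mult_right iB)
    also have "\<dots> = e / (M + 1) * M" using iB by (simp add: M_def)
    also have "\<dots> < e" using e M by (simp add: divide_simps)
    finally show "(\<integral>x. \<bar>\<phi> (x + h) - \<phi> x\<bar> \<partial>lborel) < e" .
  qed (use d in auto)
qed

lemma tendsto_L1_dominated: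
  fixes f :: "'a \<Rightarrow> real"
  assumes "integrable M w" "f \<in> borel_measurable M" "\<And>n. s n \<in> borel_measurable M"
    and "\<And>x. (\<lambda>n. s n x) \<longlonglongrightarrow> f x" "\<And>n x. \<bar>s n x\<bar> \<le> w x"
  shows "(\<lambda>n. \<integral>x. \<bar>s n x - f x\<bar> \<partial>M) \<longlonglongrightarrow> 0"
proof -
  have le: "\<bar>f x\<bar> \<le> w x" for x
    by (rule LIMSEQ_le_const2[OF tendsto_rabs[OF assms(4)]]) (use assms(5) in auto)
  have "(\<lambda>n. \<integral>x. \<bar>s n x - f x\<bar> \<partial>M) \<longlonglongrightarrow> (\<integral>x. 0 \<partial>M)"
  proof (rule integral_dominated_convergence)
    show "integrable M (\<lambda>x. 2 * w x)" using assms(1) by simp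
    show "AE x in M. (\<lambda>n. \<bar>s n x - f x\<bar>) \<longlonglongrightarrow> 0"
      using tendsto_rabs[OF LIM_zero[OF assms(4)]] by simp
    show "AE x in M. norm \<bar>s n x - f x\<bar> \<le> 2 * w x" for n
    proof (rule AE_I2)
      fix x show "norm \<bar>s n x - f x\<bar> \<le> 2 * w x" using assms(5)[of n x] le[of x] by simp
    qed
  qed (use assms in auto)
  then show ?thesis by simp
qed

text \<open>Induction over integrable functions. Indicators are the base case and are reached
  through test functions, for which uniform continuity is available.\<close>

theorem integrable_translation_continuous:
  fixes f :: "'d::euclidean_space \<Rightarrow> real"
  assumes "integrable lborel f"
  shows "translation_continuous f"
proof -
  have ib: "integrable lborel (\<lambda>x. indicator (cball 0 R) x * f x)" if "integrable lborel f" for f :: "'d \<Rightarrow> real" and R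
    using integrable_real_mult_indicator[OF _ that, of "cball 0 R"] by (simp add: mult.commute)
  \<comment> \<open>Indicators are approximated by test functions only inside compact sets, hence
    every function is cut off by a ball during the induction, for all radii at once.\<close>
  have loc: "\<forall>R. translation_continuous (\<lambda>x. indicator (cball 0 R) x * f x)"
    using assms
  proof (induct rule: integrable_induct)
    case (base A c)
    show ?case
    proof
      fix R :: real
      have A: "A \<in> sets borel" using base by simp
      have i: "integrable lborel (\<lambda>x. indicator (cball 0 R) x * (indicator A x *\<^sub>R c))"
        by (intro ib) (use base in \<open>auto intro!: integrable_mult_left\<close>)
      show "translation_continuous (\<lambda>x. indicator (cball 0 R) x * (indicator A x *\<^sub>R c))"
      proof (rule translation_continuous_limit[OF i])
        fix e :: real assume "0 < e"
        then have e': "0 < e / (\<bar>c\<bar> + 1)" by simp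
        obtain \<phi> D\<phi> where \<phi>: "test_function UNIV \<phi> D\<phi>"
          "integrable lborel (\<lambda>x. \<phi> x - indicator (A \<inter> cball 0 R) x)"
          "(\<integral>x. \<bar>\<phi> x - indicator (A \<inter> cball 0 R) x\<bar> \<partial>lborel) < e / (\<bar>c\<bar> + 1)"
          by (rule borel_indicator_approx_test_function[of "A \<inter> cball 0 R" "cball 0 R" UNIV, OF _ _ _ _ _ e'])
            (use A in auto)
        have "(\<integral>x. \<bar>c * \<phi> x - indicator (cball 0 R) x * (indicator A x *\<^sub>R c)\<bar> \<partial>lborel)
            = (\<integral>x. \<bar>c\<bar> * \<bar>\<phi> x - indicator (A \<inter> cball 0 R) x\<bar> \<partial>lborel)"
          by (intro Bochner_Integration.integral_cong) (auto simp: indicator_def abs_mult[symmetric] algebra_simps)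
        also have "\<dots> = \<bar>c\<bar> * (\<integral>x. \<bar>\<phi> x - indicator (A \<inter> cball 0 R) x\<bar> \<partial>lborel)" by simp
        also have "\<dots> \<le> \<bar>c\<bar> * (e / (\<bar>c\<bar> + 1))" using \<phi>(3) by (intro mult_left_mono) auto
        also have "\<dots> < e" using \<open>0 < e\<close> by (simp add: divide_simps)
        finally show "\<exists>g. integrable lborel g \<and> translation_continuous g \<and>
            (\<integral>x. \<bar>g x - indicator (cball 0 R) x * (indicator A x *\<^sub>R c)\<bar> \<partial>lborel) < e"
          using test_function_cmult[OF \<phi>(1), of c]
          by (intro exI[of _ "\<lambda>x. c * \<phi> x"] conjI)
            (rule test_function_integrable test_function_translation_continuous, assumption)+
      qed
    qed
  next
    case (add f g)
    then show ?case
      unfolding distrib_left by (intro allI translation_continuous_add ib) auto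
  next
    case (lim f s)
    show ?case
    proof
      fix R :: real
      have "(\<lambda>n. \<integral>x. \<bar>indicator (cball 0 R) x * s n x - indicator (cball 0 R) x * f x\<bar> \<partial>lborel) \<longlonglongrightarrow> 0"
      proof (rule tendsto_L1_dominated[where w = "\<lambda>x. 2 * \<bar>f x\<bar>"])
        show "integrable lborel (\<lambda>x. 2 * \<bar>f x\<bar>)" by (intro integrable_mult_right integrable_abs lim(5))
        show "(\<lambda>x. indicator (cball 0 R) x * f x) \<in> borel_measurable lborel"
          using ib[OF lim(5)] by (rule borel_measurable_integrable)
        show "(\<lambda>x. indicator (cball 0 R) x * s n x) \<in> borel_measurable lborel" for n
          using ib[OF lim(1)] by (rule borel_measurable_integrable)
        show "(\<lambda>n. indicator (cball 0 R) x * s n x) \<longlonglongrightarrow> indicator (cball 0 R) x * f x" for x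
          by (intro tendsto_mult tendsto_const lim(3)) simp
        show "\<bar>indicator (cball 0 R) x * s n x\<bar> \<le> 2 * \<bar>f x\<bar>" for n x
          using lim(4)[of x n] by (simp add: indicator_def)
      qed
      note lim0 = this
      show "translation_continuous (\<lambda>x. indicator (cball 0 R) x * f x)"
      proof (rule translation_continuous_limit[OF ib[OF lim(5)]])
        fix e :: real assume "0 < e"
        with lim0 have "\<forall>\<^sub>F n in sequentially.
            (\<integral>x. \<bar>indicator (cball 0 R) x * s n x - indicator (cball 0 R) x * f x\<bar> \<partial>lborel) < e"
          by (rule order_tendstoD(2))
        then obtain n where "(\<integral>x. \<bar>indicator (cball 0 R) x * s n x - indicator (cball 0 R) x * f x\<bar> \<partial>lborel) < e"
          by (auto simp: eventually_sequentially)
        then show "\<exists>g. integrable lborel g \<and> translation_continuous g \<and>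
            (\<integral>x. \<bar>g x - indicator (cball 0 R) x * f x\<bar> \<partial>lborel) < e"
          using lim(2) by (intro exI[of _ "\<lambda>x. indicator (cball 0 R) x * s n x"] conjI ib[OF lim(1)]) auto
      qed
    qed
  qed
  \<comment> \<open>The cutoff is removed by letting the radius grow, with
    \<open>\<bar>f x\<bar>\<close> as majorant.\<close>
  show ?thesis
  proof (rule translation_continuous_limit[OF assms])
    fix e :: real assume "0 < e"
    have "(\<lambda>n. \<integral>x. \<bar>indicator (cball 0 (real n)) x * f x - f x\<bar> \<partial>lborel) \<longlonglongrightarrow> 0"
    proof (rule tendsto_L1_dominated[where w = "\<lambda>x. \<bar>f x\<bar>"])
      fix x
      have "\<forall>\<^sub>F n in sequentially. indicator (cball 0 (real n)) x * f x = f x"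
      proof (rule eventually_mono[OF eventually_ge_at_top[of "nat \<lceil>norm x\<rceil>"]])
        fix n assume "nat \<lceil>norm x\<rceil> \<le> n"
        then have "norm x \<le> real n" by linarith
        then show "indicator (cball 0 (real n)) x * f x = f x" by simp
      qed
      then show "(\<lambda>n. indicator (cball 0 (real n)) x * f x) \<longlonglongrightarrow> f x"
        by (rule tendsto_eventually)
      show "\<bar>indicator (cball 0 (real n)) x * f x\<bar> \<le> \<bar>f x\<bar>" for n
        by (simp add: indicator_def)
    next
      show "(\<lambda>x. indicator (cball 0 (real n)) x * f x) \<in> borel_measurable lborel" for n
        using ib[OF assms] by (rule borel_measurable_integrable)
    qed (use assms in auto)
    then have "\<forall>\<^sub>F n in sequentially. (\<integral>x. \<bar>indicator (cball 0 (real n)) x * f x - f x\<bar> \<partial>lborel) < e"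
      using \<open>0 < e\<close> by (rule order_tendstoD(2))
    then obtain n where "(\<integral>x. \<bar>indicator (cball 0 (real n)) x * f x - f x\<bar> \<partial>lborel) < e"
      by (auto simp: eventually_sequentially)
    then show "\<exists>g. integrable lborel g \<and> translation_continuous g \<and> (\<integral>x. \<bar>g x - f x\<bar> \<partial>lborel) < e"
      using loc by (intro exI[of _ "\<lambda>x. indicator (cball 0 (real n)) x * f x"] conjI ib[OF assms]) auto
  qed
qed

subsection \<open>Difference quotients of weak derivatives\<close>

lemma test_function_translate:
  fixes V :: "'d::euclidean_space set"
  assumes "test_function W \<phi> D\<phi>" "compact K" "\<And>x. x \<notin> K \<Longrightarrow> \<phi> x = 0" "(\<lambda>x. x + c) ` K \<subseteq> V"
  shows "test_function V (\<lambda>x. \<phi> (x - c)) (\<lambda>x. D\<phi> (x - c))"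
  unfolding test_function_def
proof (intro conjI allI exI[of _ "(\<lambda>x. x + c) ` K"] impI)
  have D: "\<And>x. GDERIV \<phi> x :> D\<phi> x" "continuous_on UNIV D\<phi>"
    using assms(1) by (auto simp: test_function_def)
  show "GDERIV (\<lambda>x. \<phi> (x - c)) x :> D\<phi> (x - c)" for x
    unfolding gderiv_def
    by (rule has_derivative_compose[where f = "\<lambda>x. x - c" and f' = "\<lambda>h. h", OF _ D(1)[of "x - c", unfolded gderiv_def]])
      (auto intro!: derivative_eq_intros)
  show "continuous_on UNIV (\<lambda>x. D\<phi> (x - c))"
    by (rule continuous_on_compose2[OF D(2)]) (auto intro!: continuous_intros)
  show "compact ((\<lambda>x. x + c) ` K)"
    using compact_translation[OF assms(2), of c] by (simp add: add.commute)
  show "\<phi> (x - c) = 0" if "x \<notin> (\<lambda>x. x + c) ` K" for x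
  proof -
    have "x - c \<notin> K" using that by (metis diff_add_cancel image_eqI)
    then show ?thesis by (rule assms(3))
  qed
qed (use assms in auto)

lemma test_function_bounded:
  assumes "test_function V \<phi> D\<phi>"
  obtains B where "0 \<le> B" "\<And>x. \<bar>\<phi> x\<bar> \<le> B" "\<And>x. norm (D\<phi> x) \<le> B"
proof -
  obtain K where K: "compact K" "\<And>x. x \<notin> K \<Longrightarrow> \<phi> x = 0" "\<And>x. x \<notin> K \<Longrightarrow> D\<phi> x = 0"
    "continuous_on UNIV D\<phi>" "continuous_on UNIV \<phi>"
    using test_functionE[OF assms] by metis
  have "bounded (\<phi> ` K)" "bounded (D\<phi> ` K)"
    using K by (auto intro!: compact_imp_bounded compact_continuous_image intro: continuous_on_subset)
  then obtain a b where "\<And>x. x \<in> K \<Longrightarrow> norm (\<phi> x) \<le> a" "\<And>x. x \<in> K \<Longrightarrow> norm (D\<phi> x) \<le> b"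
    unfolding bounded_iff by fast
  moreover have "\<bar>\<phi> x\<bar> \<le> \<bar>a\<bar> + \<bar>b\<bar> \<and> norm (D\<phi> x) \<le> \<bar>a\<bar> + \<bar>b\<bar>" for x
    using calculation[of x] K(2,3)[of x] by (cases "x \<in> K") auto
  ultimately show thesis using that[of "\<bar>a\<bar> + \<bar>b\<bar>"] by auto
qed

lemma test_function_lipschitz:
  assumes "test_function V \<phi> D\<phi>" "\<And>x. norm (D\<phi> x) \<le> B"
  shows "\<bar>\<phi> x - \<phi> y\<bar> \<le> B * norm (x - y)"
proof -
  have "norm (\<phi> x - \<phi> y) \<le> B * norm (x - y)"
  proof (rule differentiable_bound[of UNIV \<phi> "\<lambda>x h. h \<bullet> D\<phi> x"])
    show "(\<phi> has_derivative (\<lambda>h. h \<bullet> D\<phi> x)) (at x)" for x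
      using assms(1) by (simp add: test_function_def gderiv_def)
    show "onorm (\<lambda>h. h \<bullet> D\<phi> x) \<le> B" for x
    proof (rule onorm_bound)
      show "0 \<le> B" using assms(2)[of x] norm_ge_zero order_trans by blast
      show "norm (h \<bullet> D\<phi> x) \<le> B * norm h" for h
        using Cauchy_Schwarz_ineq2[of h "D\<phi> x"] mult_left_mono[OF assms(2)[of x], of "norm h"]
        by (simp add: mult.commute)
    qed
  qed auto
  then show ?thesis by simp
qed

lemma test_function_integrable_mult:
  assumes "test_function V \<phi> D\<phi>" "integrable lborel u"
  shows "integrable lborel (\<lambda>x. \<phi> x * u x)" "integrable lborel (\<lambda>x. (D\<phi> x \<bullet> v) * u x)"
    "integrable lborel (\<lambda>x. \<phi> (x - c) * u x)"
proof -
  obtain K where K: "compact K" "\<And>x. x \<notin> K \<Longrightarrow> \<phi> x = 0" "\<And>x. x \<notin> K \<Longrightarrow> D\<phi> x = 0"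
    "continuous_on UNIV D\<phi>" "continuous_on UNIV \<phi>"
    using test_functionE[OF assms(1)] by metis
  have *: "integrable lborel (\<lambda>x. \<phi> x * f x)" if "integrable lborel f" for f
    by (rule integrable_mult_continuous_compact_support[OF K(5,1,2) that])
  show "integrable lborel (\<lambda>x. \<phi> x * u x)" by (rule *[OF assms(2)])
  show "integrable lborel (\<lambda>x. (D\<phi> x \<bullet> v) * u x)"
    using K by (intro integrable_mult_continuous_compact_support[of _ K] assms continuous_intros) auto
  have "integrable lborel (\<lambda>x. \<phi> x * u (x + c))"
    using * lborel_integrable_translate[OF assms(2)] by blast
  from lborel_integrable_translate[OF this, of "- c"]
  show "integrable lborel (\<lambda>x. \<phi> (x - c) * u x)" by simp
qed

text \<open>The shift is carried by \<open>\<phi>\<close>, so differentiation under the integral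
  falls on \<open>\<phi>\<close>. Its Lipschitz constant yields the majorant
  \<open>B * norm v * \<bar>u x\<bar>\<close> for all difference quotients.\<close>

lemma has_real_derivative_integral_translate:
  fixes u :: "'d::euclidean_space \<Rightarrow> real"
  assumes \<phi>: "test_function V \<phi> D\<phi>" and u: "integrable lborel u"
  shows "((\<lambda>t. \<integral>x. \<phi> (x - t *\<^sub>R v) * u x \<partial>lborel) has_real_derivative
           - (\<integral>x. (D\<phi> (x - t *\<^sub>R v) \<bullet> v) * u x \<partial>lborel)) (at t)"
proof -
  obtain B where B: "0 \<le> B" "\<And>x. norm (D\<phi> x) \<le> B" using test_function_bounded[OF \<phi>] by metis
  have D: "\<And>x. GDERIV \<phi> x :> D\<phi> x" "continuous_on UNIV D\<phi>"
    using \<phi> by (auto simp: test_function_def)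
  have [measurable]: "\<phi> \<in> borel_measurable borel" "D\<phi> \<in> borel_measurable borel" "u \<in> borel_measurable borel"
    using test_function_borel_measurable[OF \<phi>] D(2) u by (auto intro: borel_measurable_continuous_onI)
  let ?h = "\<lambda>t. \<integral>x. \<phi> (x - t *\<^sub>R v) * u x \<partial>lborel"
  have "((\<lambda>s. (?h (t + s) - ?h t) / s) \<longlongrightarrow> (\<integral>x. - (D\<phi> (x - t *\<^sub>R v) \<bullet> v) * u x \<partial>lborel)) (at 0)"
    unfolding tendsto_at_iff_sequentially
  proof (intro allI impI)
    fix X :: "nat \<Rightarrow> real" assume X: "\<forall>i. X i \<in> UNIV - {0}" "X \<longlonglongrightarrow> 0"
    have eq: "(?h (t + X n) - ?h t) / X n
        = (\<integral>x. (\<phi> (x - t *\<^sub>R v - X n *\<^sub>R v) - \<phi> (x - t *\<^sub>R v)) / X n * u x \<partial>lborel)" for n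
    proof -
      have "?h (t + X n) - ?h t = (\<integral>x. \<phi> (x - (t + X n) *\<^sub>R v) * u x - \<phi> (x - t *\<^sub>R v) * u x \<partial>lborel)"
        by (rule Bochner_Integration.integral_diff[symmetric]; rule test_function_integrable_mult(3)[OF \<phi> u])
      also have "\<dots> / X n = (\<integral>x. (\<phi> (x - (t + X n) *\<^sub>R v) * u x - \<phi> (x - t *\<^sub>R v) * u x) / X n \<partial>lborel)"
        by (rule integral_divide_zero[symmetric])
      also have "\<dots> = (\<integral>x. (\<phi> (x - t *\<^sub>R v - X n *\<^sub>R v) - \<phi> (x - t *\<^sub>R v)) / X n * u x \<partial>lborel)"
        by (intro Bochner_Integration.integral_cong) (auto simp: algebra_simps diff_divide_distrib)
      finally show ?thesis .
    qed
    have "(\<lambda>n. \<integral>x. (\<phi> (x - t *\<^sub>R v - X n *\<^sub>R v) - \<phi> (x - t *\<^sub>R v)) / X n * u x \<partial>lborel)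
        \<longlonglongrightarrow> (\<integral>x. - (D\<phi> (x - t *\<^sub>R v) \<bullet> v) * u x \<partial>lborel)"
    proof (rule integral_dominated_convergence)
      show "integrable lborel (\<lambda>x. B * norm v * \<bar>u x\<bar>)" using u by (intro integrable_mult_right integrable_abs)
      show "AE x in lborel. (\<lambda>n. (\<phi> (x - t *\<^sub>R v - X n *\<^sub>R v) - \<phi> (x - t *\<^sub>R v)) / X n * u x)
          \<longlonglongrightarrow> - (D\<phi> (x - t *\<^sub>R v) \<bullet> v) * u x"
      proof (rule AE_I2)
        fix x
        let ?y = "x - t *\<^sub>R v"
        have "((\<lambda>s. \<phi> (?y - s *\<^sub>R v)) has_derivative (\<lambda>s. (- (s *\<^sub>R v)) \<bullet> D\<phi> ?y)) (at 0)"
          by (rule has_derivative_compose[where f = "\<lambda>s. ?y - s *\<^sub>R v" and f' = "\<lambda>s. - (s *\<^sub>R v)" and g = \<phi> and g' = "\<lambda>h. h \<bullet> D\<phi> ?y"])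
            (use D(1)[of ?y] in \<open>auto simp: gderiv_def intro!: derivative_eq_intros\<close>)
        then have "((\<lambda>s. \<phi> (?y - s *\<^sub>R v)) has_real_derivative - (D\<phi> ?y \<bullet> v)) (at 0)"
          unfolding has_field_derivative_def
          by (rule back_subst[of "\<lambda>f. (_ has_derivative f) _"]) (auto simp: inner_commute fun_eq_iff)
        then have "((\<lambda>s. (\<phi> (?y - s *\<^sub>R v) - \<phi> ?y) / s) \<longlongrightarrow> - (D\<phi> ?y \<bullet> v)) (at 0)"
          by (simp add: DERIV_def)
        then have "(\<lambda>n. (\<phi> (?y - X n *\<^sub>R v) - \<phi> ?y) / X n) \<longlonglongrightarrow> - (D\<phi> ?y \<bullet> v)"
          using X unfolding tendsto_at_iff_sequentially by (auto simp: comp_def)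
        then show "(\<lambda>n. (\<phi> (?y - X n *\<^sub>R v) - \<phi> ?y) / X n * u x) \<longlonglongrightarrow> - (D\<phi> ?y \<bullet> v) * u x"
          by (intro tendsto_mult tendsto_const)
      qed
      show "AE x in lborel. norm ((\<phi> (x - t *\<^sub>R v - X n *\<^sub>R v) - \<phi> (x - t *\<^sub>R v)) / X n * u x) \<le> B * norm v * \<bar>u x\<bar>" for n
      proof (rule AE_I2)
        fix x
        have "\<bar>\<phi> (x - t *\<^sub>R v - X n *\<^sub>R v) - \<phi> (x - t *\<^sub>R v)\<bar> \<le> B * (\<bar>X n\<bar> * norm v)"
          using test_function_lipschitz[OF \<phi> B(2), of "x - t *\<^sub>R v - X n *\<^sub>R v" "x - t *\<^sub>R v"] by simp
        then have "\<bar>(\<phi> (x - t *\<^sub>R v - X n *\<^sub>R v) - \<phi> (x - t *\<^sub>R v)) / X n\<bar> \<le> B * norm v"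
          using X(1) by (simp add: divide_simps mult.assoc mult.commute mult.left_commute)
        from mult_right_mono[OF this, of "\<bar>u x\<bar>"]
        show "norm ((\<phi> (x - t *\<^sub>R v - X n *\<^sub>R v) - \<phi> (x - t *\<^sub>R v)) / X n * u x) \<le> B * norm v * \<bar>u x\<bar>"
          by (simp add: abs_mult)
      qed
    qed measurable
    then show "((\<lambda>s. (?h (t + s) - ?h t) / s) \<circ> X) \<longlonglongrightarrow> (\<integral>x. - (D\<phi> (x - t *\<^sub>R v) \<bullet> v) * u x \<partial>lborel)"
      by (simp add: comp_def eq)
  qed
  then show ?thesis by (simp add: DERIV_def)
qed

lemma lborel_integral_mult_translate:
  fixes u :: "'d::euclidean_space \<Rightarrow> real"
  assumes [measurable]: "\<phi> \<in> borel_measurable borel" "u \<in> borel_measurable borel"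
  shows "(\<integral>x. \<phi> (x - c) * u x \<partial>lborel) = (\<integral>x. \<phi> x * u (x + c) \<partial>lborel)"
  using lborel_integral_translate[of "\<lambda>x. \<phi> (x - c) * u x" c] by simp

text \<open>Mean value estimate along the shift. The decisive feature is that the bound involves
  \<open>\<psi>\<close> only through its supremum \<open>B\<close>: the derivative of
  \<open>\<psi>\<close> has been traded for \<open>p\<close>, whose translates are close in the
  mean. This permits a passage to discontinuous weights.\<close>

lemma weak_derivative_increment_test_function:
  fixes u p :: "'d::euclidean_space \<Rightarrow> real"
  assumes u: "integrable lborel u" and p: "integrable lborel p"
    and weak: "\<And>\<phi> D\<phi>. test_function V \<phi> D\<phi> \<Longrightarrow>
      (\<integral>x. (D\<phi> x \<bullet> v) * u x \<partial>lborel) = - (\<integral>x. \<phi> x * p x \<partial>lborel)"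
    and \<psi>: "test_function V \<psi> D\<psi>" and K: "compact K" "\<And>x. x \<notin> K \<Longrightarrow> \<psi> x = 0"
    and B: "\<And>x. \<bar>\<psi> x\<bar> \<le> B"
    and t: "\<And>s. \<bar>s\<bar> \<le> \<bar>t\<bar> \<Longrightarrow> (\<lambda>x. x + s *\<^sub>R v) ` K \<subseteq> V"
    and \<omega>: "\<And>s. \<bar>s\<bar> \<le> \<bar>t\<bar> \<Longrightarrow> (\<integral>x. \<bar>p (x + s *\<^sub>R v) - p x\<bar> \<partial>lborel) \<le> \<omega>"
  shows "\<bar>\<integral>x. \<psi> x * (u (x + t *\<^sub>R v) - u x - t * p x) \<partial>lborel\<bar> \<le> \<bar>t\<bar> * (B * \<omega>)"
proof -
  have B0: "0 \<le> B" using B[of undefined] by linarith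
  note mu = borel_measurable_integrable[OF u, simplified] and mp = borel_measurable_integrable[OF p, simplified]
  note m\<psi> = test_function_borel_measurable[OF \<psi>]
  \<comment> \<open>\<open>h t - h 0\<close> is the integral to be estimated, once the shift is
    moved from \<open>\<psi>\<close> to \<open>u\<close>.\<close>
  define h where "h = (\<lambda>s. (\<integral>x. \<psi> (x - s *\<^sub>R v) * u x \<partial>lborel) - s * (\<integral>x. \<psi> x * p x \<partial>lborel))"
  define h' where "h' = (\<lambda>s. (\<integral>x. \<psi> (x - s *\<^sub>R v) * p x \<partial>lborel) - (\<integral>x. \<psi> x * p x \<partial>lborel))"
  have tr: "integrable lborel (\<lambda>x. \<psi> x * f (x + c))" if "integrable lborel f" for f :: "'d \<Rightarrow> real" and c
    by (rule test_function_integrable_mult(1)[OF \<psi> lborel_integrable_translate[OF that]])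
  have h0: "integrable lborel (\<lambda>x. \<psi> x * f x)" if "integrable lborel f" for f :: "'d \<Rightarrow> real"
    by (rule test_function_integrable_mult(1)[OF \<psi> that])
  have "norm (h t - h 0) \<le> (B * \<omega>) * norm (t - 0)"
  proof (rule field_differentiable_bound[of "{-\<bar>t\<bar>..\<bar>t\<bar>}" h h'])
    fix s assume "s \<in> {-\<bar>t\<bar>..\<bar>t\<bar>}"
    then have s: "\<bar>s\<bar> \<le> \<bar>t\<bar>" by auto
    have "(h has_real_derivative - (\<integral>x. (D\<psi> (x - s *\<^sub>R v) \<bullet> v) * u x \<partial>lborel) - (\<integral>x. \<psi> x * p x \<partial>lborel)) (at s)"
      unfolding h_def
      by (rule derivative_eq_intros has_real_derivative_integral_translate[OF \<psi> u] refl | simp)+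
    moreover have "(\<integral>x. (D\<psi> (x - s *\<^sub>R v) \<bullet> v) * u x \<partial>lborel) = - (\<integral>x. \<psi> (x - s *\<^sub>R v) * p x \<partial>lborel)"
      by (rule weak, rule test_function_translate[OF \<psi> K t[OF s]])
    ultimately have "(h has_real_derivative h' s) (at s)" by (simp add: h'_def)
    then show "(h has_field_derivative h' s) (at s within {-\<bar>t\<bar>..\<bar>t\<bar>})"
      by (rule has_field_derivative_at_within)
    \<comment> \<open>After the weak identity has been applied to the translated test function,
      moving the shift onto \<open>p\<close> leaves an increment of \<open>p\<close>.\<close>
    have "h' s = (\<integral>x. \<psi> x * p (x + s *\<^sub>R v) - \<psi> x * p x \<partial>lborel)"
      unfolding h'_def lborel_integral_mult_translate[OF m\<psi> mp]
      by (rule Bochner_Integration.integral_diff[symmetric]; intro tr h0 p)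
    then have "\<bar>h' s\<bar> \<le> (\<integral>x. \<bar>\<psi> x * p (x + s *\<^sub>R v) - \<psi> x * p x\<bar> \<partial>lborel)"
      using integral_abs_bound by simp
    also have "\<dots> \<le> (\<integral>x. B * \<bar>p (x + s *\<^sub>R v) - p x\<bar> \<partial>lborel)"
    proof (rule integral_mono)
      show "integrable lborel (\<lambda>x. \<bar>\<psi> x * p (x + s *\<^sub>R v) - \<psi> x * p x\<bar>)"
        by (intro integrable_abs Bochner_Integration.integrable_diff tr h0 p)
      show "integrable lborel (\<lambda>x. B * \<bar>p (x + s *\<^sub>R v) - p x\<bar>)"
        by (intro integrable_mult_right integrable_abs Bochner_Integration.integrable_diff lborel_integrable_translate p)
      show "\<bar>\<psi> x * p (x + s *\<^sub>R v) - \<psi> x * p x\<bar> \<le> B * \<bar>p (x + s *\<^sub>R v) - p x\<bar>" for x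
        unfolding right_diff_distrib[symmetric] abs_mult by (intro mult_right_mono B) simp
    qed
    also have "\<dots> = B * (\<integral>x. \<bar>p (x + s *\<^sub>R v) - p x\<bar> \<partial>lborel)" by simp
    also have "\<dots> \<le> B * \<omega>" using \<omega>[OF s] B0 by (rule mult_left_mono)
    finally show "norm (h' s) \<le> B * \<omega>" by simp
  qed auto
  moreover have "h t - h 0 = (\<integral>x. \<psi> x * (u (x + t *\<^sub>R v) - u x - t * p x) \<partial>lborel)"
  proof -
    have "h t - h 0 = (\<integral>x. \<psi> x * u (x + t *\<^sub>R v) \<partial>lborel) - (\<integral>x. \<psi> x * u x \<partial>lborel) - (\<integral>x. t * (\<psi> x * p x) \<partial>lborel)"
      unfolding h_def lborel_integral_mult_translate[OF m\<psi> mu] by simp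
    also have "\<dots> = (\<integral>x. \<psi> x * u (x + t *\<^sub>R v) - \<psi> x * u x - t * (\<psi> x * p x) \<partial>lborel)"
      using tr[OF u] h0[OF u] h0[OF p] by simp
    also have "\<dots> = (\<integral>x. \<psi> x * (u (x + t *\<^sub>R v) - u x - t * p x) \<partial>lborel)"
      by (intro Bochner_Integration.integral_cong) (auto simp: algebra_simps)
    finally show ?thesis .
  qed
  ultimately show ?thesis by (simp add: mult.commute)
qed

text \<open>The products \<open>\<phi> x * \<psi> n x\<close> keep the support in \<open>K\<close>
  and the supremum bound \<open>B\<close>, so the estimate for test functions passes to the limit
  unchanged.\<close>

lemma weak_derivative_increment_indicator:
  fixes u p :: "'d::euclidean_space \<Rightarrow> real"
  assumes u: "integrable lborel u" and p: "integrable lborel p"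
    and weak: "\<And>\<phi> D\<phi>. test_function V \<phi> D\<phi> \<Longrightarrow>
      (\<integral>x. (D\<phi> x \<bullet> v) * u x \<partial>lborel) = - (\<integral>x. \<phi> x * p x \<partial>lborel)"
    and V: "open V" and \<phi>: "test_function V \<phi> D\<phi>"
    and K: "compact K" "K \<subseteq> V" "\<And>x. x \<notin> K \<Longrightarrow> \<phi> x = 0"
    and A: "A \<in> sets borel"
    and B: "\<And>x. \<bar>\<phi> x\<bar> \<le> B"
    and t: "\<And>s. \<bar>s\<bar> \<le> \<bar>t\<bar> \<Longrightarrow> (\<lambda>x. x + s *\<^sub>R v) ` K \<subseteq> V"
    and \<omega>: "\<And>s. \<bar>s\<bar> \<le> \<bar>t\<bar> \<Longrightarrow> (\<integral>x. \<bar>p (x + s *\<^sub>R v) - p x\<bar> \<partial>lborel) \<le> \<omega>"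
  shows "\<bar>\<integral>x. indicator A x * \<phi> x * (u (x + t *\<^sub>R v) - u x - t * p x) \<partial>lborel\<bar> \<le> \<bar>t\<bar> * (B * \<omega>)"
proof -
  have B0: "0 \<le> B" using B[of undefined] by linarith
  let ?f = "\<lambda>x. u (x + t *\<^sub>R v) - u x - t * p x"
  have f: "integrable lborel ?f"
    by (intro Bochner_Integration.integrable_diff integrable_mult_right lborel_integrable_translate u p)
  have [measurable]: "\<phi> \<in> borel_measurable borel" "A \<in> sets borel" "?f \<in> borel_measurable borel"
    using test_function_borel_measurable[OF \<phi>] A f by auto
  \<comment> \<open>Approximation requires a set inside a compact one. Replacing \<open>A\<close> by
    \<open>A \<inter> K\<close> changes nothing after multiplication by \<open>\<phi>\<close>, which
    vanishes off \<open>K\<close>.\<close>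
  obtain \<psi> D\<psi> where \<psi>: "\<And>n::nat. test_function V (\<psi> n) (D\<psi> n)" "\<And>n x. 0 \<le> \<psi> n x" "\<And>n x. \<psi> n x \<le> 1"
    "AE x in lborel. (\<lambda>n. \<psi> n x) \<longlonglongrightarrow> indicator (A \<inter> K) x"
    by (rule borel_indicator_AE_limit_test_functions[of "A \<inter> K" K V]) (use A K V in \<open>auto simp: borel_compact\<close>)
  have [measurable]: "\<psi> n \<in> borel_measurable borel" for n
    using test_function_borel_measurable[OF \<psi>(1)] .
  have "(\<lambda>n. \<integral>x. \<phi> x * \<psi> n x * ?f x \<partial>lborel) \<longlonglongrightarrow> (\<integral>x. indicator A x * \<phi> x * ?f x \<partial>lborel)"
  proof (rule integral_dominated_convergence)
    show "integrable lborel (\<lambda>x. B * \<bar>?f x\<bar>)" by (intro integrable_mult_right integrable_abs f)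
    show "AE x in lborel. (\<lambda>n. \<phi> x * \<psi> n x * ?f x) \<longlonglongrightarrow> indicator A x * \<phi> x * ?f x"
      using \<psi>(4)
    proof eventually_elim
      case (elim x)
      have "(\<lambda>n. \<phi> x * \<psi> n x * ?f x) \<longlonglongrightarrow> \<phi> x * indicator (A \<inter> K) x * ?f x"
        by (intro tendsto_mult tendsto_const elim)
      moreover have "\<phi> x * indicator (A \<inter> K) x = indicator A x * \<phi> x"
        using K(3)[of x] by (auto simp: indicator_def)
      ultimately show ?case by simp
    qed
    show "AE x in lborel. norm (\<phi> x * \<psi> n x * ?f x) \<le> B * \<bar>?f x\<bar>" for n
    proof (rule AE_I2)
      fix x
      have "\<bar>\<phi> x * \<psi> n x\<bar> \<le> B * 1"
        unfolding abs_mult using \<psi>(2,3)[of n x] B B0 by (intro mult_mono) auto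
      from mult_right_mono[OF this, of "\<bar>?f x\<bar>"]
      show "norm (\<phi> x * \<psi> n x * ?f x) \<le> B * \<bar>?f x\<bar>" by (simp add: abs_mult)
    qed
  qed measurable
  then have "(\<lambda>n. \<bar>\<integral>x. \<phi> x * \<psi> n x * ?f x \<partial>lborel\<bar>) \<longlonglongrightarrow> \<bar>\<integral>x. indicator A x * \<phi> x * ?f x \<partial>lborel\<bar>"
    by (rule tendsto_rabs)
  moreover have "\<bar>\<integral>x. \<phi> x * \<psi> n x * ?f x \<partial>lborel\<bar> \<le> \<bar>t\<bar> * (B * \<omega>)" for n
  proof (rule weak_derivative_increment_test_function[OF u p weak _ K(1)])
    show "test_function V (\<lambda>x. \<phi> x * \<psi> n x) (\<lambda>x. \<phi> x *\<^sub>R D\<psi> n x + \<psi> n x *\<^sub>R D\<phi> x)"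
      by (rule test_function_mult[OF \<phi> \<psi>(1)])
    show "\<phi> x * \<psi> n x = 0" if "x \<notin> K" for x using K(3)[OF that] by simp
    have "\<bar>\<phi> x * \<psi> n x\<bar> \<le> B * 1" for x
      unfolding abs_mult using \<psi>(2,3)[of n x] B B0 by (intro mult_mono) auto
    then show "\<bar>\<phi> x * \<psi> n x\<bar> \<le> B" for x by simp
  qed (use t \<omega> in auto)
  ultimately show ?thesis by (intro LIMSEQ_le_const2) auto
qed

lemma weak_derivative_difference_quotient:
  fixes u p :: "'d::euclidean_space \<Rightarrow> real"
  assumes u: "integrable lborel u" and p: "integrable lborel p"
    and weak: "\<And>\<phi> D\<phi>. test_function V \<phi> D\<phi> \<Longrightarrow>
      (\<integral>x. (D\<phi> x \<bullet> v) * u x \<partial>lborel) = - (\<integral>x. \<phi> x * p x \<partial>lborel)"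
    and V: "open V" and \<phi>: "test_function V \<phi> D\<phi>" and A: "A \<in> sets borel"
  shows "((\<lambda>t. (\<integral>x. indicator A x * \<phi> x * (u (x + t *\<^sub>R v) - u x) \<partial>lborel) / t)
    \<longlongrightarrow> (\<integral>x. indicator A x * \<phi> x * p x \<partial>lborel)) (at 0)"
proof (rule LIM_I)
  fix e :: real assume e: "0 < e"
  obtain K where K: "compact K" "K \<subseteq> V" "\<And>x. x \<notin> K \<Longrightarrow> \<phi> x = 0"
    using test_functionE[OF \<phi>] by metis
  obtain B where B: "0 \<le> B" "\<And>x. \<bar>\<phi> x\<bar> \<le> B" using test_function_bounded[OF \<phi>] by metis
  \<comment> \<open>The summand 1 covers \<open>B = 0\<close> and makes
    \<open>B * \<omega> < e\<close> strict.\<close>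
  define \<omega> where "\<omega> = e / (B + 1)"
  have \<omega>: "0 < \<omega>" using e B by (simp add: \<omega>_def)
  obtain d where d: "0 < d" "\<And>h. norm h < d \<Longrightarrow> (\<integral>x. \<bar>p (x + h) - p x\<bar> \<partial>lborel) < \<omega>"
    using integrable_translation_continuous[OF p] \<omega> unfolding translation_continuous_def by blast
  obtain r where r: "0 < r" "(\<Union>x\<in>K. cball x r) \<subseteq> V"
    using compact_subset_open_imp_cball_epsilon_subset[OF K(1) V K(2)] by metis
  \<comment> \<open>Shifts by \<open>s *\<^sub>R v\<close> with
    \<open>\<bar>s\<bar> < \<delta>\<close> are shorter than \<open>d\<close>, for the translation
    estimate, and than \<open>r\<close>, so that the support stays in \<open>V\<close>. The summand
    1 covers \<open>v = 0\<close>.\<close>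
  define \<delta> where "\<delta> = min d r / (norm v + 1)"
  have \<delta>: "0 < \<delta>" using d r by (auto simp: \<delta>_def add_nonneg_pos)
  have small: "norm (s *\<^sub>R v) < min d r" if "\<bar>s\<bar> < \<delta>" for s
  proof -
    have "\<bar>s\<bar> * (norm v + 1) < min d r"
      using that by (simp add: \<delta>_def less_divide_eq add_nonneg_pos)
    moreover have "\<bar>s\<bar> * norm v \<le> \<bar>s\<bar> * (norm v + 1)" by (intro mult_left_mono) auto
    ultimately show ?thesis by simp
  qed
  have int: "integrable lborel (\<lambda>x. indicator A x * \<phi> x * f x)" if "integrable lborel f" for f :: "'d \<Rightarrow> real"
    using integrable_real_mult_indicator[OF _ test_function_integrable_mult(1)[OF \<phi> that], of A] A
    by (simp add: mult_ac)
  show "\<exists>s>0. \<forall>t. t \<noteq> 0 \<and> norm (t - 0) < s \<longrightarrow>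
      norm ((\<integral>x. indicator A x * \<phi> x * (u (x + t *\<^sub>R v) - u x) \<partial>lborel) / t
        - (\<integral>x. indicator A x * \<phi> x * p x \<partial>lborel)) < e"
  proof (intro exI[of _ \<delta>] conjI allI impI \<delta>)
    fix t :: real assume t: "t \<noteq> 0 \<and> norm (t - 0) < \<delta>"
    have "\<bar>\<integral>x. indicator A x * \<phi> x * (u (x + t *\<^sub>R v) - u x - t * p x) \<partial>lborel\<bar> \<le> \<bar>t\<bar> * (B * \<omega>)"
    proof (rule weak_derivative_increment_indicator[OF u p weak V \<phi> K A B(2)])
      fix s :: real assume "\<bar>s\<bar> \<le> \<bar>t\<bar>"
      then have s: "norm (s *\<^sub>R v) < d" "norm (s *\<^sub>R v) < r" using small[of s] t by auto
      show "(\<lambda>x. x + s *\<^sub>R v) ` K \<subseteq> V"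
        using r(2) s(2) by (force simp: dist_norm)
      show "(\<integral>x. \<bar>p (x + s *\<^sub>R v) - p x\<bar> \<partial>lborel) \<le> \<omega>"
        using d(2)[OF s(1)] by simp
    qed
    moreover have "(\<integral>x. indicator A x * \<phi> x * (u (x + t *\<^sub>R v) - u x - t * p x) \<partial>lborel)
        = (\<integral>x. indicator A x * \<phi> x * (u (x + t *\<^sub>R v) - u x) \<partial>lborel) - t * (\<integral>x. indicator A x * \<phi> x * p x \<partial>lborel)"
    proof -
      have "(\<integral>x. indicator A x * \<phi> x * (u (x + t *\<^sub>R v) - u x - t * p x) \<partial>lborel)
        = (\<integral>x. indicator A x * \<phi> x * (u (x + t *\<^sub>R v) - u x) - t * (indicator A x * \<phi> x * p x) \<partial>lborel)"
        by (intro Bochner_Integration.integral_cong) (auto simp: algebra_simps)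
      also have "\<dots> = (\<integral>x. indicator A x * \<phi> x * (u (x + t *\<^sub>R v) - u x) \<partial>lborel) - (\<integral>x. t * (indicator A x * \<phi> x * p x) \<partial>lborel)"
        by (intro Bochner_Integration.integral_diff int integrable_mult_right Bochner_Integration.integrable_diff
            lborel_integrable_translate u p)
      finally show ?thesis by simp
    qed
    ultimately have "\<bar>(\<integral>x. indicator A x * \<phi> x * (u (x + t *\<^sub>R v) - u x) \<partial>lborel) / t
        - (\<integral>x. indicator A x * \<phi> x * p x \<partial>lborel)\<bar> \<le> B * \<omega>"
      using t by (simp add: abs_le_iff divide_simps split: if_splits) (auto simp: algebra_simps)
    also have "\<dots> < e" using e B(1) by (simp add: \<omega>_def divide_simps)
    finally show "norm ((\<integral>x. indicator A x * \<phi> x * (u (x + t *\<^sub>R v) - u x) \<partial>lborel) / t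
        - (\<integral>x. indicator A x * \<phi> x * p x \<partial>lborel)) < e" by simp
  qed
qed

subsection \<open>Subgradient chain rule\<close>

text \<open>\<open>Q\<close> and \<open>S\<close> are the difference quotients of \<open>w\<close>
  and, weighted by the indicator, of \<open>u\<close>. Both have two-sided limits at 0, so the
  inequality \<open>le\<close>, valid for small \<open>t\<close> of either sign, becomes an equality
  of limits after division by \<open>t\<close>.\<close>

lemma weak_derivative_subgradient_nonneg:
  fixes u p w :: "'d::euclidean_space \<Rightarrow> real"
  assumes u: "integrable lborel u" and p: "integrable lborel p" and w: "integrable lborel w"
    and weak: "\<And>\<phi> D\<phi>. test_function V \<phi> D\<phi> \<Longrightarrow>
      (\<integral>x. (D\<phi> x \<bullet> v) * u x \<partial>lborel) = - (\<integral>x. \<phi> x * p x \<partial>lborel)"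
    and V: "open V" and A: "A \<in> sets borel"
    and sub: "\<And>x y. x \<in> V \<Longrightarrow> y \<in> V \<Longrightarrow> \<sigma> * indicator A x * (u y - u x) \<le> w y - w x"
    and \<phi>: "test_function V \<phi> D\<phi>" "\<And>x. 0 \<le> \<phi> x"
  shows "(\<integral>x. (D\<phi> x \<bullet> v) * w x \<partial>lborel) = - (\<integral>x. \<phi> x * (\<sigma> * indicator A x * p x) \<partial>lborel)"
proof -
  obtain K where K: "compact K" "K \<subseteq> V" "\<And>x. x \<notin> K \<Longrightarrow> \<phi> x = 0"
    using test_functionE[OF \<phi>(1)] by metis
  obtain r where r: "0 < r" "(\<Union>x\<in>K. cball x r) \<subseteq> V"
    using compact_subset_open_imp_cball_epsilon_subset[OF K(1) V K(2)] by metis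
  define \<delta> where "\<delta> = r / (norm v + 1)"
  have \<delta>: "0 < \<delta>" using r by (auto simp: \<delta>_def add_nonneg_pos)
  \<comment> \<open>The subgradient inequality is available only between points of
    \<open>V\<close>.\<close>
  have inV: "x + t *\<^sub>R v \<in> V" if "x \<in> K" "\<bar>t\<bar> < \<delta>" for x t
  proof -
    have "\<bar>t\<bar> * (norm v + 1) < r"
      using that by (simp add: \<delta>_def less_divide_eq add_nonneg_pos)
    moreover have "\<bar>t\<bar> * norm v \<le> \<bar>t\<bar> * (norm v + 1)" by (intro mult_left_mono) auto
    ultimately have "x + t *\<^sub>R v \<in> cball x r" by (simp add: dist_norm)
    then show ?thesis using r(2) that(1) by blast
  qed
  have h0: "integrable lborel (\<lambda>x. \<phi> x * f x)" if "integrable lborel f" for f :: "'d \<Rightarrow> real"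
    by (rule test_function_integrable_mult(1)[OF \<phi>(1) that])
  have hA: "integrable lborel (\<lambda>x. indicator A x * \<phi> x * f x)" if "integrable lborel f" for f :: "'d \<Rightarrow> real"
    using integrable_real_mult_indicator[OF _ h0[OF that], of A] A by (simp add: mult_ac)
  have diff: "integrable lborel (\<lambda>x. f (x + c) - f x)" if "integrable lborel f" for f :: "'d \<Rightarrow> real" and c
    by (intro Bochner_Integration.integrable_diff lborel_integrable_translate that)
  define Q where "Q = (\<lambda>t. (\<integral>x. \<phi> x * (w (x + t *\<^sub>R v) - w x) \<partial>lborel) / t)"
  define S where "S = (\<lambda>t. (\<integral>x. indicator A x * \<phi> x * (u (x + t *\<^sub>R v) - u x) \<partial>lborel) / t)"
  have le: "\<sigma> * (\<integral>x. indicator A x * \<phi> x * (u (x + t *\<^sub>R v) - u x) \<partial>lborel)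
      \<le> (\<integral>x. \<phi> x * (w (x + t *\<^sub>R v) - w x) \<partial>lborel)" if t: "\<bar>t\<bar> < \<delta>" for t
  proof -
    have "(\<integral>x. \<sigma> * (indicator A x * \<phi> x * (u (x + t *\<^sub>R v) - u x)) \<partial>lborel)
      \<le> (\<integral>x. \<phi> x * (w (x + t *\<^sub>R v) - w x) \<partial>lborel)"
    proof (rule integral_mono)
      show "integrable lborel (\<lambda>x. \<sigma> * (indicator A x * \<phi> x * (u (x + t *\<^sub>R v) - u x)))"
        by (intro integrable_mult_right hA diff u)
      show "integrable lborel (\<lambda>x. \<phi> x * (w (x + t *\<^sub>R v) - w x))"
        by (intro h0 diff w)
      fix x
      show "\<sigma> * (indicator A x * \<phi> x * (u (x + t *\<^sub>R v) - u x)) \<le> \<phi> x * (w (x + t *\<^sub>R v) - w x)"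
      proof (cases "x \<in> K")
        case True
        from mult_left_mono[OF sub[OF _ inV[OF this t], of x] \<phi>(2)[of x]] show ?thesis
          using True K(2) by (auto simp: mult_ac)
      qed (simp add: K(3))
    qed
    then show ?thesis by simp
  qed
  have S: "((\<lambda>t. \<sigma> * S t) \<longlongrightarrow> \<sigma> * (\<integral>x. indicator A x * \<phi> x * p x \<partial>lborel)) (at 0)"
    unfolding S_def
    by (intro tendsto_mult tendsto_const weak_derivative_difference_quotient[OF u p weak V \<phi>(1) A])
  \<comment> \<open>The shift is moved back onto \<open>\<phi>\<close>, so this limit exists before
    anything is known about a weak derivative of \<open>w\<close>.\<close>
  have Q: "(Q \<longlongrightarrow> - (\<integral>x. (D\<phi> x \<bullet> v) * w x \<partial>lborel)) (at 0)"
  proof -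
    have "((\<lambda>t. ((\<integral>x. \<phi> (x - t *\<^sub>R v) * w x \<partial>lborel) - (\<integral>x. \<phi> x * w x \<partial>lborel)) / t)
        \<longlongrightarrow> - (\<integral>x. (D\<phi> x \<bullet> v) * w x \<partial>lborel)) (at 0)"
      using has_real_derivative_integral_translate[OF \<phi>(1) w, of v 0] by (simp add: DERIV_def)
    moreover have "(\<integral>x. \<phi> (x - t *\<^sub>R v) * w x \<partial>lborel) - (\<integral>x. \<phi> x * w x \<partial>lborel)
        = (\<integral>x. \<phi> x * (w (x + t *\<^sub>R v) - w x) \<partial>lborel)" for t
    proof -
      have "(\<integral>x. \<phi> (x - t *\<^sub>R v) * w x \<partial>lborel) = (\<integral>x. \<phi> x * w (x + t *\<^sub>R v) \<partial>lborel)"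
        using borel_measurable_integrable[OF w] test_function_borel_measurable[OF \<phi>(1)]
        by (intro lborel_integral_mult_translate) auto
      then show ?thesis
        using h0[OF w] h0[OF lborel_integrable_translate[OF w]] by (simp add: right_diff_distrib)
    qed
    ultimately show ?thesis by (simp add: Q_def)
  qed
  have near: "\<forall>\<^sub>F t in at 0. \<bar>t\<bar> < \<delta> \<and> t \<noteq> 0"
    using \<delta> unfolding eventually_at by (intro exI[of _ \<delta>]) auto
  have "\<forall>\<^sub>F t in at_right 0. \<sigma> * S t \<le> Q t"
  proof -
    have "\<forall>\<^sub>F t in at_right 0. (\<bar>t\<bar> < \<delta> \<and> t \<noteq> 0) \<and> 0 < t"
      by (rule eventually_conj[OF conjunct2[OF near[unfolded eventually_at_split]] eventually_at_right_less])
    then show ?thesis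
    proof eventually_elim
      case (elim t)
      then have "\<bar>t\<bar> < \<delta>" "0 \<le> t" by auto
      from divide_right_mono[OF le[OF this(1)] this(2)] show ?case by (simp add: S_def Q_def)
    qed
  qed
  then have 1: "\<sigma> * (\<integral>x. indicator A x * \<phi> x * p x \<partial>lborel) \<le> - (\<integral>x. (D\<phi> x \<bullet> v) * w x \<partial>lborel)"
    using S Q by (intro tendsto_le[of "at_right 0"]) (auto simp: filterlim_at_split)
  have "\<forall>\<^sub>F t in at_left 0. Q t \<le> \<sigma> * S t"
  proof -
    have "\<forall>\<^sub>F t in at_left 0. (\<bar>t\<bar> < \<delta> \<and> t \<noteq> 0) \<and> t < 0"
      by (rule eventually_conj[OF conjunct1[OF near[unfolded eventually_at_split]]]) (simp add: eventually_at_filter)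
    then show ?thesis
    proof eventually_elim
      case (elim t)
      then have "\<bar>t\<bar> < \<delta>" "t \<le> 0" by auto
      from divide_right_mono_neg[OF le[OF this(1)] this(2)] show ?case by (simp add: S_def Q_def)
    qed
  qed
  then have 2: "- (\<integral>x. (D\<phi> x \<bullet> v) * w x \<partial>lborel) \<le> \<sigma> * (\<integral>x. indicator A x * \<phi> x * p x \<partial>lborel)"
    using S Q by (intro tendsto_le[of "at_left 0"]) (auto simp: filterlim_at_split)
  have "(\<integral>x. \<phi> x * (\<sigma> * indicator A x * p x) \<partial>lborel) = (\<integral>x. \<sigma> * (indicator A x * \<phi> x * p x) \<partial>lborel)"
    by (intro Bochner_Integration.integral_cong) (auto simp: mult_ac)
  then show ?thesis using 1 2 by simp
qed

text \<open>Both sides are linear in the test function, and \<open>\<phi>\<close> is the difference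
  of the nonnegative test functions \<open>\<phi> + c * \<eta>\<close> and
  \<open>c * \<eta>\<close>.\<close>

lemma weak_derivative_subgradient:
  fixes u p w :: "'d::euclidean_space \<Rightarrow> real"
  assumes u: "integrable lborel u" and p: "integrable lborel p" and w: "integrable lborel w"
    and weak: "\<And>\<phi> D\<phi>. test_function V \<phi> D\<phi> \<Longrightarrow>
      (\<integral>x. (D\<phi> x \<bullet> v) * u x \<partial>lborel) = - (\<integral>x. \<phi> x * p x \<partial>lborel)"
    and V: "open V" and A: "A \<in> sets borel"
    and sub: "\<And>x y. x \<in> V \<Longrightarrow> y \<in> V \<Longrightarrow> \<sigma> * indicator A x * (u y - u x) \<le> w y - w x"
    and \<phi>: "test_function V \<phi> D\<phi>"
  shows "(\<integral>x. (D\<phi> x \<bullet> v) * w x \<partial>lborel) = - (\<integral>x. \<phi> x * (\<sigma> * indicator A x * p x) \<partial>lborel)"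
proof -
  obtain K where K: "compact K" "K \<subseteq> V" "\<And>x. x \<notin> K \<Longrightarrow> \<phi> x = 0"
    using test_functionE[OF \<phi>] by metis
  obtain B where B: "0 \<le> B" "\<And>x. \<bar>\<phi> x\<bar> \<le> B" using test_function_bounded[OF \<phi>] by metis
  obtain \<eta> D\<eta> where \<eta>: "test_function V \<eta> D\<eta>" "\<And>x. 0 \<le> \<eta> x" "\<And>x. x \<in> K \<Longrightarrow> 1 - 1/2 < \<eta> x"
    using compact_cutoff[OF K(1) V K(2), of "1/2"] by (metis half_gt_zero zero_less_one)
  \<comment> \<open>Since \<open>\<eta> > 1/2\<close> on \<open>K\<close>, the product
    \<open>c * \<eta>\<close> dominates \<open>\<bar>\<phi>\<bar>\<close> there; off
    \<open>K\<close> the function \<open>\<phi>\<close> is 0.\<close>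
  define c where "c = 2 * B"
  let ?\<eta> = "\<lambda>x. c * \<eta> x" and ?D\<eta> = "\<lambda>x. c *\<^sub>R D\<eta> x"
  let ?q = "\<lambda>x. \<sigma> * indicator A x * p x"
  have c\<eta>: "test_function V ?\<eta> ?D\<eta>" by (rule test_function_cmult[OF \<eta>(1)])
  have sum: "test_function V (\<lambda>x. \<phi> x + ?\<eta> x) (\<lambda>x. D\<phi> x + ?D\<eta> x)" by (rule test_function_add[OF \<phi> c\<eta>])
  have "0 \<le> \<phi> x + ?\<eta> x" for x
  proof (cases "x \<in> K")
    case True
    have "2 * B * (1 / 2) \<le> c * \<eta> x"
      unfolding c_def using B(1) \<eta>(3)[OF True] by (intro mult_left_mono) auto
    then show ?thesis using B(2)[of x] by (simp add: abs_le_iff)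
  next
    case False
    then show ?thesis using K(3) B(1) \<eta>(2) by (simp add: c_def)
  qed
  have N: "(\<integral>x. (D\<zeta> x \<bullet> v) * w x \<partial>lborel) = - (\<integral>x. \<zeta> x * ?q x \<partial>lborel)"
    if "test_function V \<zeta> D\<zeta>" "\<And>x. 0 \<le> \<zeta> x" for \<zeta> D\<zeta>
    by (rule weak_derivative_subgradient_nonneg[OF u p w weak V A sub that])
  have n1: "(\<integral>x. ((D\<phi> x + ?D\<eta> x) \<bullet> v) * w x \<partial>lborel) = - (\<integral>x. (\<phi> x + ?\<eta> x) * ?q x \<partial>lborel)"
    by (rule N[OF sum]) (use \<open>\<And>x. 0 \<le> \<phi> x + ?\<eta> x\<close> in auto)
  have n2: "(\<integral>x. (?D\<eta> x \<bullet> v) * w x \<partial>lborel) = - (\<integral>x. ?\<eta> x * ?q x \<partial>lborel)"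
    by (rule N[OF c\<eta>]) (use B(1) \<eta>(2) in \<open>auto simp: c_def\<close>)
  have q: "integrable lborel ?q"
    using integrable_mult_right[OF integrable_real_mult_indicator[OF _ p, of A], of \<sigma>] A by (simp add: mult_ac)
  have "(\<integral>x. ((D\<phi> x + ?D\<eta> x) \<bullet> v) * w x \<partial>lborel) = (\<integral>x. (D\<phi> x \<bullet> v) * w x \<partial>lborel) + (\<integral>x. (?D\<eta> x \<bullet> v) * w x \<partial>lborel)"
    unfolding inner_add_left distrib_right
    by (rule Bochner_Integration.integral_add[OF test_function_integrable_mult(2)[OF \<phi> w] test_function_integrable_mult(2)[OF c\<eta> w]])
  moreover have "(\<integral>x. (\<phi> x + ?\<eta> x) * ?q x \<partial>lborel) = (\<integral>x. \<phi> x * ?q x \<partial>lborel) + (\<integral>x. ?\<eta> x * ?q x \<partial>lborel)"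
    unfolding distrib_right
    by (rule Bochner_Integration.integral_add[OF test_function_integrable_mult(1)[OF \<phi> q] test_function_integrable_mult(1)[OF c\<eta> q]])
  ultimately show ?thesis using n1 n2 by simp
qed

section \<open>The fundamental lemma of the calculus of variations\<close>

lemma test_function_integral_zero_imp_AE_nonpos:
  fixes w :: "'d::euclidean_space \<Rightarrow> real"
  assumes w: "integrable lborel w"
    and z: "\<And>\<phi> D\<phi>. test_function V \<phi> D\<phi> \<Longrightarrow> (\<integral>x. \<phi> x * w x \<partial>lborel) = 0"
    and V: "open V" and K: "compact K" "K \<subseteq> V"
  shows "AE x in lborel. x \<in> K \<longrightarrow> w x \<le> 0"
proof -
  \<comment> \<open>Test functions converging to the indicator of \<open>A\<close> show that the
    integral of \<open>w\<close> over \<open>A\<close> is 0, although \<open>w\<close> is positive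
    there; so \<open>A\<close> is a null set.\<close>
  define A where "A = {x \<in> K. 0 < w x}"
  have [measurable]: "w \<in> borel_measurable borel" using w by auto
  have [measurable]: "K \<in> sets borel" using K by (simp add: borel_compact)
  have A [measurable]: "A \<in> sets borel" unfolding A_def by measurable
  obtain \<psi> D\<psi> where \<psi>: "\<And>n::nat. test_function V (\<psi> n) (D\<psi> n)" "\<And>n x. 0 \<le> \<psi> n x" "\<And>n x. \<psi> n x \<le> 1"
    "AE x in lborel. (\<lambda>n. \<psi> n x) \<longlonglongrightarrow> indicator A x"
    by (rule borel_indicator_AE_limit_test_functions[of A K V]) (use A K V in \<open>auto simp: A_def\<close>)
  have [measurable]: "\<psi> n \<in> borel_measurable borel" for n
    using test_function_borel_measurable[OF \<psi>(1)] .
  have "(\<lambda>n. \<integral>x. \<psi> n x * w x \<partial>lborel) \<longlonglongrightarrow> (\<integral>x. indicator A x * w x \<partial>lborel)"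
  proof (rule integral_dominated_convergence)
    show "integrable lborel (\<lambda>x. \<bar>w x\<bar>)" by (intro integrable_abs w)
    show "AE x in lborel. (\<lambda>n. \<psi> n x * w x) \<longlonglongrightarrow> indicator A x * w x"
      using \<psi>(4) by eventually_elim (intro tendsto_mult tendsto_const)
    show "AE x in lborel. norm (\<psi> n x * w x) \<le> \<bar>w x\<bar>" for n
      using \<psi>(2,3)[of n] by (intro AE_I2) (auto simp: abs_mult intro!: mult_left_le_one_le)
  qed measurable
  then have "(\<integral>x. indicator A x * w x \<partial>lborel) = 0"
    using z[OF \<psi>(1)] LIMSEQ_unique[OF _ tendsto_const] by simp
  moreover have "integrable lborel (\<lambda>x. indicator A x * w x)"
    using integrable_real_mult_indicator[OF _ w, of A] A by (simp add: mult.commute)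
  moreover have "0 \<le> indicator A x * w x" for x by (simp add: A_def indicator_def)
  ultimately have "AE x in lborel. indicator A x * w x = 0"
    by (simp add: integral_nonneg_eq_0_iff_AE)
  then show ?thesis
    by eventually_elim (auto simp: A_def indicator_def split: if_splits)
qed

lemma test_function_integral_zero_imp_AE_zero:
  fixes w :: "'d::euclidean_space \<Rightarrow> real"
  assumes w: "integrable lborel w"
    and z: "\<And>\<phi> D\<phi>. test_function V \<phi> D\<phi> \<Longrightarrow> (\<integral>x. \<phi> x * w x \<partial>lborel) = 0"
    and V: "open V" and K: "compact K" "K \<subseteq> V"
  shows "AE x in lborel. x \<in> K \<longrightarrow> w x = 0"
proof -
  have "AE x in lborel. x \<in> K \<longrightarrow> w x \<le> 0"
    by (rule test_function_integral_zero_imp_AE_nonpos[OF w z V K])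
  moreover have "AE x in lborel. x \<in> K \<longrightarrow> - w x \<le> 0"
    by (rule test_function_integral_zero_imp_AE_nonpos[OF _ _ V K]) (use w z in auto)
  ultimately show ?thesis by eventually_elim auto
qed

subsection \<open>Weak gradients\<close>

text \<open>The closed \<open>r\<close>-neighbourhood of \<open>K\<close>, written as a Minkowski
  sum to obtain compactness. Its interior is the open set in which the localised functions still
  satisfy the weak identity.\<close>

lemma compact_neighbourhood:
  fixes K :: "'d::euclidean_space set"
  assumes "compact K" "open \<Omega>" "K \<subseteq> \<Omega>"
  obtains C where "compact C" "C \<subseteq> \<Omega>" "K \<subseteq> interior C"
proof -
  obtain r where r: "0 < r" "(\<Union>x\<in>K. cball x r) \<subseteq> \<Omega>"
    using compact_subset_open_imp_cball_epsilon_subset[OF assms] by metis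
  let ?C = "{x + y | x y. x \<in> K \<and> y \<in> cball 0 r}"
  have "cball x r \<subseteq> ?C" if "x \<in> K" for x
  proof
    fix z assume "z \<in> cball x r"
    then show "z \<in> ?C"
      using that by (intro CollectI exI[of _ x] exI[of _ "z - x"]) (auto simp: dist_norm norm_minus_commute)
  qed
  then have "K \<subseteq> interior ?C"
    using r(1) by (meson ball_subset_cball centre_in_ball interiorI open_ball order_trans subsetI)
  moreover have "?C \<subseteq> \<Omega>" using r(2) by (fastforce simp: dist_norm)
  moreover have "compact ?C" by (intro compact_sums assms compact_cball)
  ultimately show thesis using that by blast
qed

section \<open>From Lebesgue integrals over the domain to Borel functions on the whole space\<close>

lemma absolutely_integrable_on_borel_representative:
  fixes f :: "'d::euclidean_space \<Rightarrow> real"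
  assumes f: "f absolutely_integrable_on C" and C: "compact C"
  obtains f' where "integrable lborel f'" "AE x in lebesgue. x \<in> C \<longrightarrow> f' x = f x" "\<And>x. x \<notin> C \<Longrightarrow> f' x = 0"
proof -
  have i: "integrable lebesgue (\<lambda>x. indicator C x *\<^sub>R f x)"
    using f by (simp add: set_integrable_def)
  then obtain g where g: "g \<in> borel_measurable lborel" "AE x in lborel. indicator C x *\<^sub>R f x = g x"
    using completion_ex_borel_measurable_real[OF borel_measurable_integrable[OF i]] by metis
  have [measurable]: "C \<in> sets borel" using C by (simp add: borel_compact)
  \<comment> \<open>The factor \<open>indicator C x\<close> makes \<open>f'\<close> vanish
    everywhere off \<open>C\<close>, whereas \<open>g\<close> does so only almost
    everywhere.\<close>
  define f' where "f' = (\<lambda>x. indicator C x * g x)"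
  have m: "f' \<in> borel_measurable lborel" unfolding f'_def using g(1) by measurable
  have ae: "AE x in lebesgue. indicator C x *\<^sub>R f x = g x" using g(2) by (rule AE_completion)
  have "integrable lebesgue f'"
  proof (rule integrable_cong_AE_imp[OF i])
    show "f' \<in> borel_measurable lebesgue" using m by (rule measurable_completion)
    show "AE x in lebesgue. indicator C x *\<^sub>R f x = f' x"
      using ae by eventually_elim (auto simp: f'_def indicator_def)
  qed
  then have "integrable lborel f'" using m by (simp add: integrable_completion)
  moreover have "AE x in lebesgue. x \<in> C \<longrightarrow> f' x = f x"
    using ae by eventually_elim (auto simp: f'_def)
  ultimately show thesis using that by (auto simp: f'_def)
qed

lemma set_integral_eq_lborel_integral:
  fixes F f :: "'d::euclidean_space \<Rightarrow> real"
  assumes f: "f absolutely_integrable_on C" and C: "C \<subseteq> \<Omega>" and F: "continuous_on UNIV F" "\<And>x. x \<notin> C \<Longrightarrow> F x = 0"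
    and f': "integrable lborel f'" "AE x in lebesgue. x \<in> C \<longrightarrow> f' x = f x"
  shows "(LINT x:\<Omega>|lebesgue. F x * f x) = (\<integral>x. F x * f' x \<partial>lborel)"
proof -
  have Fm: "F \<in> borel_measurable borel" using F(1) by (rule borel_measurable_continuous_onI)
  have m: "(\<lambda>x. F x * f' x) \<in> borel_measurable lborel"
    using Fm borel_measurable_integrable[OF f'(1)] by measurable
  have m2: "(\<lambda>x. indicator \<Omega> x *\<^sub>R (F x * f x)) \<in> borel_measurable lebesgue"
  proof -
    \<comment> \<open>Because \<open>F\<close> vanishes off \<open>C\<close>, the indicator of
      \<open>\<Omega>\<close> can be traded for that of \<open>C\<close>, and measurability is
      inherited from integrability of \<open>f\<close> on \<open>C\<close>.\<close>
    have "(\<lambda>x. indicator \<Omega> x *\<^sub>R (F x * f x)) = (\<lambda>x. F x * (indicator C x *\<^sub>R f x))"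
      using C F(2) by (auto simp: indicator_def fun_eq_iff)
    moreover have "F \<in> borel_measurable lebesgue" using Fm by (intro measurable_completion) simp
    moreover have "(\<lambda>x. indicator C x *\<^sub>R f x) \<in> borel_measurable lebesgue"
      by (rule borel_measurable_integrable[OF f[unfolded set_integrable_def]])
    ultimately show ?thesis by (simp only: borel_measurable_times)
  qed
  have "(LINT x:\<Omega>|lebesgue. F x * f x) = (\<integral>x. F x * f' x \<partial>lebesgue)"
    unfolding set_lebesgue_integral_def
  proof (rule integral_cong_AE[OF m2])
    show "(\<lambda>x. F x * f' x) \<in> borel_measurable lebesgue" using m by (rule measurable_completion)
    show "AE x in lebesgue. indicator \<Omega> x *\<^sub>R (F x * f x) = F x * f' x"
      using f'(2) by eventually_elim (use C F(2) in \<open>auto simp: indicator_def\<close>)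
  qed
  also have "\<dots> = (\<integral>x. F x * f' x \<partial>lborel)" using m by (rule integral_completion)
  finally show ?thesis .
qed

text \<open>Turns one side of the vector-valued weak identity into a scalar one. The inner product
  passes under the integral because the bound on \<open>D\<phi>\<close>, which vanishes off
  \<open>C\<close>, makes the integrand integrable; the next lemma treats the other side.\<close>

lemma set_integral_scaleR_test_gradient_inner:
  fixes u :: "'d::euclidean_space \<Rightarrow> real"
  assumes u: "u absolutely_integrable_on C" and C: "C \<subseteq> \<Omega>" and \<phi>: "test_function V \<phi> D\<phi>" "\<And>x. x \<notin> C \<Longrightarrow> D\<phi> x = 0"
  shows "(LINT x:\<Omega>|lebesgue. u x *\<^sub>R D\<phi> x) \<bullet> e = (LINT x:\<Omega>|lebesgue. (D\<phi> x \<bullet> e) * u x)"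
proof -
  obtain B where B: "\<And>x. norm (D\<phi> x) \<le> B" using test_function_bounded[OF \<phi>(1)] by metis
  have m: "D\<phi> \<in> borel_measurable lebesgue"
    using \<phi>(1) by (intro measurable_completion) (simp add: test_function_def borel_measurable_continuous_onI)
  have i: "integrable lebesgue (\<lambda>x. indicator C x *\<^sub>R u x)"
    using u by (simp add: set_integrable_def)
  have eq: "indicator \<Omega> x *\<^sub>R (u x *\<^sub>R D\<phi> x) = (indicator C x *\<^sub>R u x) *\<^sub>R D\<phi> x" for x
    using C \<phi>(2)[of x] by (auto simp: indicator_def)
  have "integrable lebesgue (\<lambda>x. indicator \<Omega> x *\<^sub>R (u x *\<^sub>R D\<phi> x))"
    unfolding eq
  proof (intro Bochner_Integration.integrable_bound[OF integrable_mult_right[OF integrable_norm[OF i], of B]])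
    show "AE x in lebesgue. norm ((indicator C x *\<^sub>R u x) *\<^sub>R D\<phi> x) \<le> norm (B * norm (indicator C x *\<^sub>R u x))"
    proof (rule AE_I2)
      fix x
      have "0 \<le> B" using order_trans[OF norm_ge_zero B[of x]] .
      then show "norm ((indicator C x *\<^sub>R u x) *\<^sub>R D\<phi> x) \<le> norm (B * norm (indicator C x *\<^sub>R u x))"
        using mult_right_mono[OF B[of x], of "norm (indicator C x *\<^sub>R u x)"] by (simp add: mult.commute abs_mult)
    qed
  qed (rule borel_measurable_scaleR[OF borel_measurable_integrable[OF i] m])
  then show ?thesis
    unfolding set_lebesgue_integral_def
    by (subst integral_inner_left[symmetric]) (auto simp: mult_ac)
qed

lemma set_integral_test_scaleR_inner:
  fixes G :: "'d::euclidean_space \<Rightarrow> 'd"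
  assumes G: "G absolutely_integrable_on C" and C: "C \<subseteq> \<Omega>" and \<phi>: "test_function V \<phi> D\<phi>" "\<And>x. x \<notin> C \<Longrightarrow> \<phi> x = 0"
  shows "(LINT x:\<Omega>|lebesgue. \<phi> x *\<^sub>R G x) \<bullet> e = (LINT x:\<Omega>|lebesgue. \<phi> x * (G x \<bullet> e))"
proof -
  obtain B where B: "\<And>x. \<bar>\<phi> x\<bar> \<le> B" using test_function_bounded[OF \<phi>(1)] by metis
  have m: "\<phi> \<in> borel_measurable lebesgue"
    using test_function_borel_measurable[OF \<phi>(1)] by (intro measurable_completion) simp
  have i: "integrable lebesgue (\<lambda>x. indicator C x *\<^sub>R G x)"
    using G by (simp add: set_integrable_def)
  have eq: "indicator \<Omega> x *\<^sub>R (\<phi> x *\<^sub>R G x) = \<phi> x *\<^sub>R (indicator C x *\<^sub>R G x)" for x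
    using C \<phi>(2)[of x] by (auto simp: indicator_def)
  have "integrable lebesgue (\<lambda>x. indicator \<Omega> x *\<^sub>R (\<phi> x *\<^sub>R G x))"
    unfolding eq
  proof (intro Bochner_Integration.integrable_bound[OF integrable_mult_right[OF integrable_norm[OF i], of B]])
    show "AE x in lebesgue. norm (\<phi> x *\<^sub>R (indicator C x *\<^sub>R G x)) \<le> norm (B * norm (indicator C x *\<^sub>R G x))"
    proof (rule AE_I2)
      fix x
      have "0 \<le> B" using order_trans[OF abs_ge_zero B[of x]] .
      then show "norm (\<phi> x *\<^sub>R (indicator C x *\<^sub>R G x)) \<le> norm (B * norm (indicator C x *\<^sub>R G x))"
        using mult_right_mono[OF B[of x], of "norm (indicator C x *\<^sub>R G x)"] by (simp add: abs_mult)
    qed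
  qed (rule borel_measurable_scaleR[OF m borel_measurable_integrable[OF i]])
  then show ?thesis
    unfolding set_lebesgue_integral_def
    by (subst integral_inner_left[symmetric]) (auto simp: mult.assoc)
qed

lemma absolutely_integrable_on_inner:
  fixes G :: "'d::euclidean_space \<Rightarrow> 'd"
  assumes "G absolutely_integrable_on C"
  shows "(\<lambda>x. G x \<bullet> e) absolutely_integrable_on C"
  using absolutely_integrable_linear[OF assms bounded_linear_inner_left[of e]] by (simp add: comp_def)

lemma has_weak_gradient_absolutely_integrable_on:
  assumes "has_weak_gradient \<Omega> u G" "compact C" "C \<subseteq> \<Omega>"
  shows "u absolutely_integrable_on C" "G absolutely_integrable_on C"
  using assms unfolding has_weak_gradient_def locally_integrable_on_def by blast+

text \<open>Localisation of the weak identity in direction \<open>e\<close>. It holds for arbitrary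
  Borel representatives on \<open>C\<close>, since test functions supported in
  \<open>interior C\<close> see nothing outside \<open>C\<close>.\<close>

lemma has_weak_gradient_imp_lborel:
  fixes u :: "'d::euclidean_space \<Rightarrow> real"
  assumes u: "has_weak_gradient \<Omega> u G" and C: "compact C" "C \<subseteq> \<Omega>"
    and u': "integrable lborel u'" "AE x in lebesgue. x \<in> C \<longrightarrow> u' x = u x"
    and p': "integrable lborel p'" "AE x in lebesgue. x \<in> C \<longrightarrow> p' x = G x \<bullet> e"
    and \<phi>: "test_function (interior C) \<phi> D\<phi>"
  shows "(\<integral>x. (D\<phi> x \<bullet> e) * u' x \<partial>lborel) = - (\<integral>x. \<phi> x * p' x \<partial>lborel)"
proof -
  obtain K where K: "K \<subseteq> interior C" "\<And>x. x \<notin> K \<Longrightarrow> \<phi> x = 0" "\<And>x. x \<notin> K \<Longrightarrow> D\<phi> x = 0"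
      "continuous_on UNIV D\<phi>" "continuous_on UNIV \<phi>"
    using test_functionE[OF \<phi>] by metis
  then have z: "\<And>x. x \<notin> C \<Longrightarrow> \<phi> x = 0" "\<And>x. x \<notin> C \<Longrightarrow> D\<phi> x = 0"
    using interior_subset by blast+
  have i: "u absolutely_integrable_on C" "G absolutely_integrable_on C"
    by (rule has_weak_gradient_absolutely_integrable_on[OF u C])+
  have "test_function \<Omega> \<phi> D\<phi>"
    by (rule test_function_mono[OF \<phi>]) (use C(2) interior_subset in blast)
  then have "(LINT x:\<Omega>|lebesgue. u x *\<^sub>R D\<phi> x) \<bullet> e = (- (LINT x:\<Omega>|lebesgue. \<phi> x *\<^sub>R G x)) \<bullet> e"
    using u by (simp add: has_weak_gradient_def)
  moreover have "(LINT x:\<Omega>|lebesgue. (D\<phi> x \<bullet> e) * u x) = (\<integral>x. (D\<phi> x \<bullet> e) * u' x \<partial>lborel)"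
    by (rule set_integral_eq_lborel_integral[OF i(1) C(2) _ _ u']) (use z K in \<open>auto intro!: continuous_intros\<close>)
  moreover have "(LINT x:\<Omega>|lebesgue. \<phi> x * (G x \<bullet> e)) = (\<integral>x. \<phi> x * p' x \<partial>lborel)"
    by (rule set_integral_eq_lborel_integral[OF absolutely_integrable_on_inner[OF i(2)] C(2) K(5) z(1) p'])
  ultimately show ?thesis
    using set_integral_scaleR_test_gradient_inner[OF i(1) C(2) \<phi> z(2), of e]
      set_integral_test_scaleR_inner[OF i(2) C(2) \<phi> z(1), of e] by (simp add: inner_minus_left)
qed

text \<open>On a compact set, each component of \<open>G - H\<close> has a Borel representative
  annihilated by all test functions, so the fundamental lemma applies; both gradients are tested
  with the same representative \<open>u'\<close>.\<close>

lemma has_weak_gradient_unique: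
  fixes u :: "'d::euclidean_space \<Rightarrow> real"
  assumes "has_weak_gradient \<Omega> u G" "has_weak_gradient \<Omega> u H" "open \<Omega>"
  shows "AE x\<in>\<Omega> in lebesgue. G x = H x"
proof -
  have loc: "AE x in lebesgue. x \<in> K \<longrightarrow> G x = H x" if K: "compact K" "K \<subseteq> \<Omega>" for K
  proof -
    obtain C where C: "compact C" "C \<subseteq> \<Omega>" "K \<subseteq> interior C"
      using compact_neighbourhood[OF K(1) \<open>open \<Omega>\<close> K(2)] by metis
    have i: "u absolutely_integrable_on C" "G absolutely_integrable_on C" "H absolutely_integrable_on C"
      using has_weak_gradient_absolutely_integrable_on[OF assms(1) C(1,2)]
        has_weak_gradient_absolutely_integrable_on[OF assms(2) C(1,2)] by auto
    obtain u' where u': "integrable lborel u'" "AE x in lebesgue. x \<in> C \<longrightarrow> u' x = u x"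
      using absolutely_integrable_on_borel_representative[OF i(1) C(1)] by metis
    have "AE x in lebesgue. \<forall>e\<in>Basis. x \<in> K \<longrightarrow> G x \<bullet> e = H x \<bullet> e"
    proof (rule AE_finite_allI)
      fix e :: 'd
      obtain p where p: "integrable lborel p" "AE x in lebesgue. x \<in> C \<longrightarrow> p x = G x \<bullet> e"
        using absolutely_integrable_on_borel_representative[OF absolutely_integrable_on_inner[OF i(2)] C(1)] by metis
      obtain q where q: "integrable lborel q" "AE x in lebesgue. x \<in> C \<longrightarrow> q x = H x \<bullet> e"
        using absolutely_integrable_on_borel_representative[OF absolutely_integrable_on_inner[OF i(3)] C(1)] by metis
      have "AE x in lborel. x \<in> K \<longrightarrow> p x - q x = 0"
      proof (rule test_function_integral_zero_imp_AE_zero[OF _ _ open_interior K(1) C(3)])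
        show "integrable lborel (\<lambda>x. p x - q x)" by (intro Bochner_Integration.integrable_diff p(1) q(1))
        fix \<phi> :: "'d \<Rightarrow> real" and D\<phi> assume \<phi>: "test_function (interior C) \<phi> D\<phi>"
        have "(\<integral>x. \<phi> x * (p x - q x) \<partial>lborel) = (\<integral>x. \<phi> x * p x \<partial>lborel) - (\<integral>x. \<phi> x * q x \<partial>lborel)"
          unfolding right_diff_distrib
          by (rule Bochner_Integration.integral_diff[OF test_function_integrable_mult(1)[OF \<phi> p(1)]
                test_function_integrable_mult(1)[OF \<phi> q(1)]])
        then show "(\<integral>x. \<phi> x * (p x - q x) \<partial>lborel) = 0"
          using has_weak_gradient_imp_lborel[OF assms(1) C(1,2) u' p \<phi>]
            has_weak_gradient_imp_lborel[OF assms(2) C(1,2) u' q \<phi>] by linarith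
      qed
      from AE_completion[OF this] p(2) q(2) show "AE x in lebesgue. x \<in> K \<longrightarrow> G x \<bullet> e = H x \<bullet> e"
      proof eventually_elim
        case (elim x)
        show ?case
        proof
          assume "x \<in> K"
          then have "x \<in> C" using C(3) interior_subset by blast
          with elim \<open>x \<in> K\<close> show "G x \<bullet> e = H x \<bullet> e" by simp
        qed
      qed
    qed simp
    then show ?thesis
    proof eventually_elim
      case (elim x)
      show ?case
      proof
        assume "x \<in> K"
        show "G x = H x" by (rule euclidean_eqI) (use elim \<open>x \<in> K\<close> in blast)
      qed
    qed
  qed
  \<comment> \<open>Each compact set brings its own exceptional null set, so \<open>\<Omega>\<close>
    is exhausted by countably many boxes.\<close>
  obtain \<D> where \<D>: "countable \<D>" "\<D> \<subseteq> Pow \<Omega>" "\<And>X. X \<in> \<D> \<Longrightarrow> \<exists>a b. X = cbox a b" "\<Union>\<D> = \<Omega>"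
  proof (rule open_countable_Union_open_cbox[OF \<open>open \<Omega>\<close>])
    fix \<D> assume "countable \<D>" "\<D> \<subseteq> Pow \<Omega>" "\<And>X. X \<in> \<D> \<Longrightarrow> \<exists>a b. X = cbox a b" "\<Union>\<D> = \<Omega>"
    then show thesis by (rule that)
  qed
  have "AE x in lebesgue. x \<in> X \<longrightarrow> G x = H x" if "X \<in> \<D>" for X
  proof (rule loc)
    show "compact X" using \<D>(3)[OF that] by (elim exE) simp
    show "X \<subseteq> \<Omega>" using subsetD[OF \<D>(2) that] by simp
  qed
  then have "AE x in lebesgue. \<forall>X\<in>\<D>. x \<in> X \<longrightarrow> G x = H x"
    by (intro AE_ball_countable[OF \<D>(1), THEN iffD2] ballI)
  then show ?thesis
  proof eventually_elim
    case (elim x)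
    show ?case
    proof
      assume "x \<in> \<Omega>"
      then obtain X where "X \<in> \<D>" "x \<in> X" unfolding \<D>(4)[symmetric] by (rule UnionE)
      with elim show "G x = H x" by blast
    qed
  qed
qed

text \<open>By \<open>sub\<close>, the number \<open>\<sigma>\<close> where \<open>P\<close> holds
  and 0 elsewhere is a subgradient of \<open>E\<close>; the form covers upper
  (\<open>\<sigma> = 1\<close>) and lower (\<open>\<sigma> = - 1\<close>) truncations at once.
  Linear growth of \<open>E\<close> gives local integrability, and the condition on \<open>P\<close>
  makes the active set of a Borel representative a Borel set.\<close>

lemma has_weak_gradient_subgradient:
  fixes u :: "'d::euclidean_space \<Rightarrow> real" and E :: "real \<Rightarrow> real"
  assumes u: "has_weak_gradient \<Omega> u G" and \<Omega>: "open \<Omega>"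
    and P: "{t. P t} \<in> sets borel" and E: "E \<in> borel_measurable borel" "\<And>t. \<bar>E t\<bar> \<le> \<bar>t\<bar> + c"
    and sub: "\<And>x y. (if P x then \<sigma> * (y - x) else 0) \<le> E y - E x"
  shows "has_weak_gradient \<Omega> (\<lambda>x. E (u x)) (\<lambda>x. if P (u x) then \<sigma> *\<^sub>R G x else 0)"
  unfolding has_weak_gradient_def
proof (intro conjI allI impI)
  let ?H = "\<lambda>x. if P (u x) then \<sigma> *\<^sub>R G x else 0"
  have i: "u absolutely_integrable_on C" "G absolutely_integrable_on C" if "compact C" "C \<subseteq> \<Omega>" for C
    by (rule has_weak_gradient_absolutely_integrable_on[OF u that])+
  have iE: "(\<lambda>x. E (u x)) absolutely_integrable_on C" and iH: "?H absolutely_integrable_on C"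
    if C: "compact C" "C \<subseteq> \<Omega>" for C
  proof -
    have CL: "C \<in> sets lebesgue" using C by (simp add: borel_compact)
    have um: "u \<in> borel_measurable (lebesgue_on C)"
      using i(1)[OF C] CL by (simp add: absolutely_integrable_measurable)
    have Gm: "G \<in> borel_measurable (lebesgue_on C)"
      using i(2)[OF C] CL by (simp add: absolutely_integrable_measurable)
    show "(\<lambda>x. E (u x)) absolutely_integrable_on C"
    proof (rule measurable_bounded_by_integrable_imp_absolutely_integrable[OF _ CL])
      show "(\<lambda>x. E (u x)) \<in> borel_measurable (lebesgue_on C)"
        using um E(1) by (rule measurable_compose)
      have "(\<lambda>x. c) integrable_on C"
        using C(1) by (simp add: integrable_on_const lmeasurable_compact)
      moreover have "(\<lambda>x. \<bar>u x\<bar>) integrable_on C"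
        using i(1)[OF C] by (simp add: absolutely_integrable_on_def)
      ultimately show "(\<lambda>x. \<bar>u x\<bar> + c) integrable_on C" by (intro integrable_add)
      show "norm (E (u x)) \<le> \<bar>u x\<bar> + c" for x using E(2) by simp
    qed
    show "?H absolutely_integrable_on C"
    proof (rule measurable_bounded_by_integrable_imp_absolutely_integrable[OF _ CL])
      have "{x \<in> space (lebesgue_on C). P (u x)} \<in> sets (lebesgue_on C)"
        using measurable_sets[OF um P] by (simp add: vimage_def Int_def conj_commute)
      then show "?H \<in> borel_measurable (lebesgue_on C)"
        using Gm by (intro measurable_If) auto
      have "(\<lambda>x. norm (G x)) integrable_on C"
        using i(2)[OF C] by (simp add: absolutely_integrable_on_def)
      then show "(\<lambda>x. \<bar>\<sigma>\<bar> * norm (G x)) integrable_on C" by (rule integrable_on_mult_right)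
      show "norm (?H x) \<le> \<bar>\<sigma>\<bar> * norm (G x)" for x by auto
    qed
  qed
  show "(\<lambda>x. E (u x)) locally_integrable_on \<Omega>" "?H locally_integrable_on \<Omega>"
    using iE iH by (auto simp: locally_integrable_on_def)
  fix \<phi> :: "'d \<Rightarrow> real" and D\<phi> assume \<phi>: "test_function \<Omega> \<phi> D\<phi>"
  obtain K where K: "compact K" "K \<subseteq> \<Omega>" "\<And>x. x \<notin> K \<Longrightarrow> \<phi> x = 0" "\<And>x. x \<notin> K \<Longrightarrow> D\<phi> x = 0"
    and D: "\<And>x. GDERIV \<phi> x :> D\<phi> x" "continuous_on UNIV D\<phi>" "continuous_on UNIV \<phi>"
    using test_functionE[OF \<phi>] by metis
  obtain C where C: "compact C" "C \<subseteq> \<Omega>" "K \<subseteq> interior C"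
    using compact_neighbourhood[OF K(1) \<Omega> K(2)] by metis
  have CB: "C \<in> sets borel" using C by (simp add: borel_compact)
  have KC: "K \<subseteq> C" using C(3) interior_subset by blast
  then have z: "\<And>x. x \<notin> C \<Longrightarrow> \<phi> x = 0" "\<And>x. x \<notin> C \<Longrightarrow> D\<phi> x = 0" using K by blast+
  have \<phi>': "test_function (interior C) \<phi> D\<phi>"
    using D K(1,3) C(3) unfolding test_function_def by blast
  obtain u' where u': "integrable lborel u'" "AE x in lebesgue. x \<in> C \<longrightarrow> u' x = u x"
    using absolutely_integrable_on_borel_representative[OF i(1)[OF C(1,2)] C(1)] by metis
  have u'm: "u' \<in> borel_measurable borel" using u'(1) by auto
  \<comment> \<open>The representative \<open>u'\<close> can be taken 0 off \<open>C\<close>, but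
    \<open>E 0\<close> may differ from 0, as for the lower truncation at positive \<open>k\<close>;
    the indicator restores integrability on the whole space.\<close>
  define w' where "w' = (\<lambda>x. indicator C x * E (u' x))"
  have w'i: "integrable lborel w'"
  proof (rule Bochner_Integration.integrable_bound)
    have "integrable lborel (indicator C :: 'd \<Rightarrow> real)"
      using CB emeasure_compact_finite[OF C(1)] by (intro integrable_real_indicator) auto
    then show "integrable lborel (\<lambda>x. \<bar>u' x\<bar> + c * indicator C x)"
      by (intro Bochner_Integration.integrable_add integrable_abs u' integrable_mult_right)
    show "w' \<in> borel_measurable lborel" unfolding w'_def using CB E(1) u'm by measurable
    show "AE x in lborel. norm (w' x) \<le> norm (\<bar>u' x\<bar> + c * indicator C x)"
    proof (rule AE_I2)
      fix x show "norm (w' x) \<le> norm (\<bar>u' x\<bar> + c * indicator C x)"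
        using E(2)[of "u' x"] by (simp add: w'_def indicator_def)
    qed
  qed
  define A where "A = {x. P (u' x)}"
  have A: "A \<in> sets borel"
    using measurable_sets[OF u'm P] by (simp add: A_def vimage_def)
  have w'ae: "AE x in lebesgue. x \<in> C \<longrightarrow> w' x = E (u x)"
    using u'(2) by eventually_elim (simp add: w'_def)
  show "(LINT x:\<Omega>|lebesgue. E (u x) *\<^sub>R D\<phi> x) = - (LINT x:\<Omega>|lebesgue. \<phi> x *\<^sub>R ?H x)"
  proof (rule euclidean_eqI)
    fix e :: 'd
    obtain p where p: "integrable lborel p" "AE x in lebesgue. x \<in> C \<longrightarrow> p x = G x \<bullet> e"
      using absolutely_integrable_on_borel_representative[OF absolutely_integrable_on_inner[OF i(2)[OF C(1,2)]] C(1)] by metis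
    have "(LINT x:\<Omega>|lebesgue. E (u x) *\<^sub>R D\<phi> x) \<bullet> e = (LINT x:\<Omega>|lebesgue. (D\<phi> x \<bullet> e) * E (u x))"
      by (rule set_integral_scaleR_test_gradient_inner[OF iE[OF C(1,2)] C(2) \<phi>' z(2)])
    also have "\<dots> = (\<integral>x. (D\<phi> x \<bullet> e) * w' x \<partial>lborel)"
      by (rule set_integral_eq_lborel_integral[OF iE[OF C(1,2)] C(2) _ _ w'i w'ae])
        (use z D in \<open>auto intro!: continuous_intros\<close>)
    also have "\<dots> = - (\<integral>x. \<phi> x * (\<sigma> * indicator A x * p x) \<partial>lborel)"
    proof (rule weak_derivative_subgradient[OF u'(1) p(1) w'i _ open_interior A _ \<phi>'])
      show "(\<integral>x. (D\<psi> x \<bullet> e) * u' x \<partial>lborel) = - (\<integral>x. \<psi> x * p x \<partial>lborel)"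
        if "test_function (interior C) \<psi> D\<psi>" for \<psi> D\<psi>
        by (rule has_weak_gradient_imp_lborel[OF u C(1,2) u' p that])
      show "\<sigma> * indicator A x * (u' y - u' x) \<le> w' y - w' x" if "x \<in> interior C" "y \<in> interior C" for x y
      proof -
        have "x \<in> C" "y \<in> C" using that interior_subset by blast+
        then show ?thesis using sub[of "u' x" "u' y"]
          by (cases "P (u' x)") (simp_all add: w'_def A_def indicator_def)
      qed
    qed
    also have "(\<integral>x. \<phi> x * (\<sigma> * indicator A x * p x) \<partial>lborel) = (LINT x:\<Omega>|lebesgue. \<phi> x * (?H x \<bullet> e))"
    proof (rule set_integral_eq_lborel_integral[OF absolutely_integrable_on_inner[OF iH[OF C(1,2)]] C(2) D(3) z(1), symmetric])
      show "integrable lborel (\<lambda>x. \<sigma> * indicator A x * p x)"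
        using integrable_mult_right[OF integrable_real_mult_indicator[OF _ p(1), of A], of \<sigma>] A by (simp add: mult_ac)
      show "AE x in lebesgue. x \<in> C \<longrightarrow> \<sigma> * indicator A x * p x = ?H x \<bullet> e"
        using u'(2) p(2) by eventually_elim (auto simp: A_def indicator_def)
    qed
    also have "\<dots> = (LINT x:\<Omega>|lebesgue. \<phi> x *\<^sub>R ?H x) \<bullet> e"
      by (rule set_integral_test_scaleR_inner[OF iH[OF C(1,2)] C(2) \<phi>' z(1), symmetric])
    finally show "(LINT x:\<Omega>|lebesgue. E (u x) *\<^sub>R D\<phi> x) \<bullet> e = (- (LINT x:\<Omega>|lebesgue. \<phi> x *\<^sub>R ?H x)) \<bullet> e"
      by simp
  qed
qed

subsection \<open>The functions Phi\<close>

lemma active_borel: "{t. active s k t} \<in> sets borel"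
  by (cases s) simp_all

lemma active_eventually:
  assumes "active s k t"
  shows "\<forall>\<^sub>F t' in nhds t. active s k t'"
  using assms eventually_nhds_in_open[of "{k<..}" t] eventually_nhds_in_open[of "{..<k}" t]
  by (cases s) simp_all

definition node_poly :: "nat set \<Rightarrow> (nat \<Rightarrow> real) \<Rightarrow> real \<Rightarrow> real" where
  "node_poly A z s = (\<Prod>j\<in>A. z j - s)"

text \<open>Sign and limits of integration do not depend on \<open>A\<close>, so partial derivatives
  stay within the family. The upper limit \<open>z i\<close> remains when \<open>i\<close> has been
  deleted from \<open>A\<close>; that case produces the second derivative in
  \<open>z i\<close>.\<close>

definition Psi :: "nat set \<Rightarrow> nat \<Rightarrow> real \<Rightarrow> (nat \<Rightarrow> real) \<Rightarrow> real" where
  "Psi A i k z = (-1) ^ (i - 1) * (LBINT s=ereal k..ereal (z i). node_poly A z s)"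


lemma continuous_on_node_poly: "continuous_on S (node_poly A z)"
  unfolding node_poly_def by (intro continuous_intros)

lemma node_poly_insert: "finite A \<Longrightarrow> j \<in> A \<Longrightarrow> node_poly A z s = (z j - s) * node_poly (A - {j}) z s"
  unfolding node_poly_def by (rule prod.remove)

lemma Phi_eq_Psi:
  assumes "i \<in> {1..m}"
  shows "Phi m i k = Psi {1..m} i k"
proof -
  have "node_poly {1..m} z = (\<lambda>s. (z i - s) * node_poly ({1..m} - {i}) z s)" for z
    using node_poly_insert[OF _ assms] by blast
  then show ?thesis by (simp add: Phi_def Psi_def fun_eq_iff) (simp add: node_poly_def)
qed

lemma node_poly_upd: "j \<notin> A \<Longrightarrow> node_poly A (z(j := t)) = node_poly A z"
  by (auto simp: node_poly_def fun_eq_iff intro!: prod.cong)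

section \<open>Differentiation of the oriented integrals in the nodes and in the end point\<close>

lemma interval_integrable_continuous:
  fixes f :: "real \<Rightarrow> real"
  assumes "continuous_on UNIV f"
  shows "interval_lebesgue_integrable lborel (ereal a) (ereal b) f"
  using assms by (intro interval_integrable_isCont) (auto simp: continuous_on_eq_continuous_at)

lemma interval_integral_has_real_derivative:
  fixes f :: "real \<Rightarrow> real"
  assumes "continuous_on UNIV f"
  shows "((\<lambda>t. LBINT s=ereal k..ereal t. f s) has_real_derivative f x) (at x)"
proof -
  \<comment> \<open>The interval is widened by 1 on both sides to make \<open>x\<close> an interior
    point, so the derivative is two-sided also at \<open>x = k\<close>.\<close>
  have "((\<lambda>t. LBINT s=k..t. f s) has_vector_derivative f x) (at x within {min k x - 1..max k x + 1})"
    by (rule interval_integral_FTC2) (use assms in \<open>auto intro: continuous_on_subset\<close>)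
  then have "((\<lambda>t. LBINT s=k..t. f s) has_vector_derivative f x) (at x)"
    by (subst (asm) at_within_interior) (auto simp: min_def max_def)
  then show ?thesis by (simp add: has_real_derivative_iff_has_vector_derivative)
qed

text \<open>Makes the affine dependence on one node explicit; differentiation in that node and the
  difference of two node deletions are both read off from this form.\<close>

lemma interval_integral_linear_factor:
  fixes f :: "real \<Rightarrow> real"
  assumes "continuous_on UNIV f"
  shows "(LBINT s=ereal a..ereal b. (t - s) * f s)
    = t * (LBINT s=ereal a..ereal b. f s) - (LBINT s=ereal a..ereal b. s * f s)"
proof -
  have "(LBINT s=ereal a..ereal b. (t - s) * f s) = (LBINT s=ereal a..ereal b. t * f s - s * f s)"
    by (simp add: left_diff_distrib)
  also have "\<dots> = (LBINT s=ereal a..ereal b. t * f s) - (LBINT s=ereal a..ereal b. s * f s)"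
    by (intro interval_lebesgue_integral_diff interval_integrable_continuous continuous_intros assms)
  finally show ?thesis by simp
qed

lemma Psi_has_real_derivative:
  assumes "finite A" "j \<in> A"
  shows "((\<lambda>t. Psi A i k (z(j := t))) has_real_derivative Psi (A - {j}) i k z) (at (z j))"
proof -
  let ?Q = "node_poly (A - {j}) z"
  have Q: "node_poly A (z(j := t)) = (\<lambda>s. (t - s) * ?Q s)" for t
    using node_poly_insert[OF assms, of "z(j := t)"] by (simp add: node_poly_upd fun_eq_iff)
  note cQ = continuous_on_node_poly[of UNIV "A - {j}" z]
  have csQ: "continuous_on UNIV (\<lambda>s. s * ?Q s)" by (intro continuous_intros cQ)
  show ?thesis
  proof (cases "j = i")
    case True
    \<comment> \<open>With \<open>j = i\<close> the variable is both a node and the end point. The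
      terms \<open>z j * ?Q (z j)\<close> from the derivatives of \<open>t * I t\<close> and of
      \<open>J\<close> cancel, which leaves \<open>I\<close>.\<close>
    define I where "I = (\<lambda>t. LBINT s=ereal k..ereal t. ?Q s)"
    define J where "J = (\<lambda>t. LBINT s=ereal k..ereal t. s * ?Q s)"
    have IJ: "(I has_real_derivative ?Q (z j)) (at (z j))" "(J has_real_derivative z j * ?Q (z j)) (at (z j))"
      unfolding I_def J_def
      by (rule interval_integral_has_real_derivative[OF cQ] interval_integral_has_real_derivative[OF csQ])+
    have "Psi A i k (z(j := t)) = (-1) ^ (i - 1) * (t * I t - J t)" for t
      unfolding Psi_def Q interval_integral_linear_factor[OF cQ] I_def J_def using True by simp
    moreover have "((\<lambda>t. (-1) ^ (i - 1) * (t * I t - J t)) has_real_derivative (-1) ^ (i - 1) * I (z j)) (at (z j))"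
      by (auto intro!: derivative_eq_intros IJ)
    ultimately show ?thesis using True by (simp add: Psi_def I_def)
  next
    case False
    have "Psi A i k (z(j := t)) = (-1) ^ (i - 1) * (t * (LBINT s=ereal k..ereal (z i). ?Q s) - (LBINT s=ereal k..ereal (z i). s * ?Q s))" for t
      unfolding Psi_def Q interval_integral_linear_factor[OF cQ] using False by simp
    moreover have "((\<lambda>t. (-1) ^ (i - 1) * (t * (LBINT s=ereal k..ereal (z i). ?Q s) - (LBINT s=ereal k..ereal (z i). s * ?Q s)))
      has_real_derivative Psi (A - {j}) i k z) (at (z j))"
      by (auto intro!: derivative_eq_intros simp: Psi_def)
    ultimately show ?thesis by simp
  qed
qed

lemma partial_Psi: "finite A \<Longrightarrow> j \<in> A \<Longrightarrow> partial j (Psi A i k) = Psi (A - {j}) i k"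
  unfolding partial_def fun_eq_iff by (blast intro: DERIV_imp_deriv Psi_has_real_derivative)

lemma partial_Psi_notin: "j \<notin> A \<Longrightarrow> j \<noteq> i \<Longrightarrow> partial j (Psi A i k) z = 0"
  by (simp add: partial_def Psi_def node_poly_upd)

text \<open>With node \<open>i\<close> deleted, \<open>z i\<close> occurs only as the end point, so
  the integrand is evaluated there.\<close>

lemma partial_Psi_diagonal:
  assumes "i \<notin> A"
  shows "partial i (Psi A i k) z = (-1) ^ (i - 1) * node_poly A z (z i)"
  unfolding partial_def Psi_def using assms
  by (auto intro!: DERIV_imp_deriv derivative_eq_intros interval_integral_has_real_derivative continuous_on_node_poly
      simp: node_poly_upd)

lemma partial_Phi: "i \<in> {1..m} \<Longrightarrow> j \<in> {1..m} \<Longrightarrow> partial j (Phi m i k) = Psi ({1..m} - {j}) i k"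
  by (simp add: Phi_eq_Psi partial_Psi)

lemma partial2_Phi_mixed:
  "i \<in> {1..m} \<Longrightarrow> j \<in> {1..m} \<Longrightarrow> l \<in> {1..m} \<Longrightarrow> j \<noteq> l \<Longrightarrow> partial2 j l (Phi m i k) = Psi ({1..m} - {j, l}) i k"
  by (simp add: partial2_def partial_Phi partial_Psi Diff_insert2[symmetric] insert_commute)

lemma partial2_Phi_diagonal:
  "i \<in> {1..m} \<Longrightarrow> partial2 i i (Phi m i k) z = (-1) ^ (i - 1) * node_poly ({1..m} - {i}) z (z i)"
  by (simp add: partial2_def partial_Phi partial_Psi_diagonal)

lemma partial2_Phi_offdiagonal:
  "i \<in> {1..m} \<Longrightarrow> j \<in> {1..m} \<Longrightarrow> j \<noteq> i \<Longrightarrow> partial2 j j (Phi m i k) z = 0"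
  by (simp add: partial2_def partial_Phi partial_Psi_notin)

text \<open>The integrands on the right share all other nodes, and
  \<open>(z l - s) - (z j - s) = z l - z j\<close> is a constant that leaves the integral. Read for
  derivatives of \<open>Phi\<close>, this is the Euler-Poisson-Darboux relation.\<close>

lemma Psi_difference:
  assumes "finite A" "j \<in> A" "l \<in> A" "j \<noteq> l"
  shows "(z l - z j) * Psi (A - {j, l}) i k z = Psi (A - {j}) i k z - Psi (A - {l}) i k z"
proof -
  let ?Q = "node_poly (A - {j, l}) z"
  have Q: "node_poly (A - {j}) z = (\<lambda>s. (z l - s) * ?Q s)" "node_poly (A - {l}) z = (\<lambda>s. (z j - s) * ?Q s)"
    using node_poly_insert[of "A - {j}" l z] node_poly_insert[of "A - {l}" j z] assms
    by (auto simp: fun_eq_iff Diff_insert2[symmetric] insert_commute)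
  show ?thesis
    unfolding Psi_def Q interval_integral_linear_factor[OF continuous_on_node_poly[of UNIV]]
    by (simp add: algebra_simps)
qed

lemma Euler_Poisson_Darboux_Phi:
  assumes "i \<in> {1..m}" "j \<in> {1..m}" "l \<in> {1..m}" "j \<noteq> l"
  shows "(z l - z j) * partial2 j l (Phi m i k) z = partial j (Phi m i k) z - partial l (Phi m i k) z"
  using assms Psi_difference[of "{1..m}" j l z i k] by (simp add: partial2_Phi_mixed partial_Phi)

section \<open>Bounds for oriented integrals\<close>

lemma interval_integral_mono:
  fixes f g :: "real \<Rightarrow> real"
  assumes "a \<le> b" "continuous_on UNIV f" "continuous_on UNIV g" "\<And>s. s \<in> {a..b} \<Longrightarrow> f s \<le> g s"
  shows "(LBINT s=ereal a..ereal b. f s) \<le> (LBINT s=ereal a..ereal b. g s)"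
proof -
  have i: "f integrable_on {a..b}" "g integrable_on {a..b}"
    using assms(2,3) by (auto intro: integrable_continuous_real continuous_on_subset)
  have "set_integrable lborel {a..b} f" "set_integrable lborel {a..b} g"
    using assms(2,3) by (auto intro!: borel_integrable_atLeastAtMost' intro: continuous_on_subset)
  then show ?thesis
    using integral_le[OF i assms(4)] assms(1) by (simp add: interval_integral_eq_integral)
qed

lemma interval_integral_abs_le:
  fixes f :: "real \<Rightarrow> real"
  assumes f: "continuous_on UNIV f" and B: "\<And>s. s \<in> {min a b..max a b} \<Longrightarrow> \<bar>f s\<bar> \<le> B"
  shows "\<bar>LBINT s=ereal a..ereal b. f s\<bar> \<le> B * \<bar>b - a\<bar>"
proof -
  have le: "\<bar>LBINT s=ereal a..ereal b. f s\<bar> \<le> B * (b - a)" if "a \<le> b" "\<And>s. s \<in> {a..b} \<Longrightarrow> \<bar>f s\<bar> \<le> B" for a b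
  proof -
    have "(LBINT s=ereal a..ereal b. f s) \<le> (LBINT s=ereal a..ereal b. B)"
         "(LBINT s=ereal a..ereal b. - B) \<le> (LBINT s=ereal a..ereal b. f s)"
      by (rule interval_integral_mono; use that f abs_le_D1 abs_le_D2 in force)+
    then show ?thesis using that(1) by (simp add: abs_le_iff algebra_simps)
  qed
  show ?thesis
  proof (cases "a \<le> b")
    case True
    then show ?thesis using le[of a b] B by simp
  next
    case False
    then show ?thesis using le[of b a] B
      by (subst interval_integral_endpoints_reverse) simp
  qed
qed

text \<open>For \<open>t < k\<close> the weight \<open>t - s\<close> and the orientation both change
  sign, so \<open>lo\<close> and \<open>hi\<close> keep their roles and one statement serves both
  truncations.\<close>

lemma interval_integral_linear_weight_bounds:
  fixes f :: "real \<Rightarrow> real"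
  assumes f: "continuous_on UNIV f" and B: "\<And>s. s \<in> {min k t..max k t} \<Longrightarrow> lo \<le> f s \<and> f s \<le> hi"
  shows "lo * (t - k)\<^sup>2 / 2 \<le> (LBINT s=ereal k..ereal t. (t - s) * f s)"
    and "(LBINT s=ereal k..ereal t. (t - s) * f s) \<le> hi * (t - k)\<^sup>2 / 2"
proof -
  have prim: "(LBINT s=ereal k..ereal t. (t - s) * c) = c * (t - k)\<^sup>2 / 2" for c
  proof -
    have "(LBINT s=ereal k..ereal t. (t - s) * c) = - ((t - t)\<^sup>2 * c / 2) - - ((t - k)\<^sup>2 * c / 2)"
    proof (rule interval_integral_FTC_finite)
      show "continuous_on {min k t..max k t} (\<lambda>s. (t - s) * c)" by (intro continuous_intros)
      show "((\<lambda>s. - ((t - s)\<^sup>2 * c / 2)) has_vector_derivative (t - s) * c) (at s within {min k t..max k t})" for s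
        unfolding has_real_derivative_iff_has_vector_derivative[symmetric]
        by (auto intro!: derivative_eq_intros simp: field_simps)
    qed
    then show ?thesis by (simp add: mult.commute)
  qed
  have c: "continuous_on UNIV (\<lambda>s. (t - s) * f s)" "continuous_on UNIV (\<lambda>s. (t - s) * c)" for c
    by (intro continuous_intros f)+
  have "(LBINT s=ereal k..ereal t. (t - s) * lo) \<le> (LBINT s=ereal k..ereal t. (t - s) * f s) \<and>
    (LBINT s=ereal k..ereal t. (t - s) * f s) \<le> (LBINT s=ereal k..ereal t. (t - s) * hi)"
  proof (cases "k \<le> t")
    case True
    then show ?thesis
      using B by (intro conjI interval_integral_mono c) (auto intro!: mult_left_mono)
  next
    case False
    then have "(LBINT s=ereal t..ereal k. (t - s) * f s) \<le> (LBINT s=ereal t..ereal k. (t - s) * lo)"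
      "(LBINT s=ereal t..ereal k. (t - s) * hi) \<le> (LBINT s=ereal t..ereal k. (t - s) * f s)"
      using False B by (intro interval_integral_mono c mult_left_mono_neg; simp)+
    then show ?thesis
      unfolding interval_integral_endpoints_reverse[of "ereal k"] by simp
  qed
  then show "lo * (t - k)\<^sup>2 / 2 \<le> (LBINT s=ereal k..ereal t. (t - s) * f s)"
    and "(LBINT s=ereal k..ereal t. (t - s) * f s) \<le> hi * (t - k)\<^sup>2 / 2"
    unfolding prim by auto
qed

subsection \<open>Truncations and the quadratic form\<close>

text \<open>The slope of \<open>excess s k\<close> on its active side.\<close>

fun side_sign :: "side \<Rightarrow> real" where
  "side_sign Upper = 1"
| "side_sign Lower = - 1"

text \<open>At the kink every slope between 0 and \<open>side_sign s\<close> is a subgradient;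
  choosing 0 lets the gradient be cut off by the strict condition \<open>active\<close>, exactly as
  \<open>Phi_trunc_hess\<close> is.\<close>

lemma has_weak_gradient_excess:
  fixes u :: "'d::euclidean_space \<Rightarrow> real"
  assumes "has_weak_gradient \<Omega> u G" "open \<Omega>"
  shows "has_weak_gradient \<Omega> (\<lambda>x. excess s k (u x)) (\<lambda>x. if active s k (u x) then side_sign s *\<^sub>R G x else 0)"
proof (rule has_weak_gradient_subgradient[OF assms active_borel])
  have "excess s k = (\<lambda>t. case s of Upper \<Rightarrow> max (t - k) 0 | Lower \<Rightarrow> max (k - t) 0)"
    by (cases s) (simp_all add: fun_eq_iff)
  then show "excess s k \<in> borel_measurable borel" by (cases s) simp_all
  show "\<bar>excess s k t\<bar> \<le> \<bar>t\<bar> + \<bar>k\<bar>" for t by (cases s) auto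
  show "(if active s k x then side_sign s * (y - x) else 0) \<le> excess s k y - excess s k x" for x y
    by (cases s) (auto simp: max_def)
qed

lemma abs_diff_active:
  "active s k t \<Longrightarrow> \<bar>t - k\<bar> = excess s k t" "active s k t \<Longrightarrow> (excess s k t)\<^sup>2 = (t - k)\<^sup>2"
  by (cases s; simp add: power2_commute)+

text \<open>The active condition is open in \<open>z i\<close> and unaffected by the other
  coordinates, so the truncation agrees with \<open>Phi\<close> near the point along each
  axis.\<close>

lemma partial_Phi_trunc_active:
  assumes "active s k (z i)"
  shows "partial j (Phi_trunc s m i k) z = partial j (Phi m i k) z"
  unfolding partial_def
proof (rule deriv_cong_ev)
  show "\<forall>\<^sub>F t in nhds (z j). Phi_trunc s m i k (z(j := t)) = Phi m i k (z(j := t))"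
  proof (cases "j = i")
    case True
    then show ?thesis
      using active_eventually[OF assms] by (auto simp: Phi_trunc_def elim: eventually_mono)
  qed (use assms in \<open>simp add: Phi_trunc_def\<close>)
qed simp

text \<open>The quadratic form contains ordinary first derivatives of the truncation, so they must
  be known at the kink \<open>z i = k\<close> as well.\<close>

lemma partial_Phi_trunc_inactive:
  assumes i: "i \<in> {1..m}" and z: "\<not> active s k (z i)"
  shows "partial j (Phi_trunc s m i k) z = 0"
proof (cases "j = i")
  case False
  then show ?thesis using z by (simp add: partial_def Phi_trunc_def)
next
  case True
  let ?F = "\<lambda>t. Phi m i k (z(i := t))" and ?T = "\<lambda>t. Phi_trunc s m i k (z(i := t))"
  have "(?T has_real_derivative 0) (at (z i))"
  proof (cases "z i = k")
    case False
    \<comment> \<open>The opposite side: its active set is open, contains \<open>z i\<close>, and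
      the truncation is 0 on it.\<close>
    obtain s' where s': "active s' k (z i)" "\<And>t. active s' k t \<Longrightarrow> \<not> active s k t"
      using z False by (cases s) (auto intro: that[of Lower] that[of Upper])
    have "((\<lambda>_. 0) has_real_derivative 0) (at (z i))" by simp
    moreover have "\<forall>\<^sub>F t in nhds (z i). 0 = ?T t"
      using active_eventually[OF s'(1)] by eventually_elim (simp add: Phi_trunc_def s'(2))
    ultimately show ?thesis by (rule DERIV_cong_ev[OF refl _ refl, THEN iffD1, rotated])
  next
    case True
    \<comment> \<open>At \<open>z i = k\<close> both \<open>Phi\<close> and its derivative in
      \<open>z i\<close> are integrals over a degenerate interval, hence 0. The truncation is
      dominated by the absolute value of \<open>Phi\<close> and inherits the derivative 0.\<close>
    have "(?F has_real_derivative Psi ({1..m} - {i}) i k z) (at (z i))"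
      using Psi_has_real_derivative[of "{1..m}" i i k z] i by (simp add: Phi_eq_Psi)
    then have "((\<lambda>h. (?F (k + h) - ?F k) / h) \<longlongrightarrow> 0) (at 0)"
      using True by (simp add: DERIV_def Psi_def)
    moreover have "?F k = 0" by (simp add: Phi_def)
    ultimately have F: "((\<lambda>h. ?F (k + h) / h) \<longlongrightarrow> 0) (at 0)" by simp
    have "((\<lambda>h. ?T (k + h) / h) \<longlongrightarrow> 0) (at 0)"
      by (rule Lim_null_comparison[OF _ tendsto_norm_zero[OF F]])
        (auto intro!: always_eventually simp: Phi_trunc_def)
    moreover have "?T k = 0" using z True by (simp add: Phi_trunc_def)
    ultimately show ?thesis using True by (simp add: DERIV_def)
  qed
  then show ?thesis using True by (simp add: partial_def DERIV_imp_deriv)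
qed

text \<open>Of the diagonal only \<open>j = i\<close> remains, because \<open>Phi\<close> is affine
  in every other node. Injectivity keeps the quotients genuine: at \<open>z j = z l\<close> the
  value of the division would be 0 by default and could not cancel the mixed derivative.\<close>

lemma Q_Phi_trunc_eq:
  fixes \<Xi> :: "nat \<Rightarrow> 'd::euclidean_space"
  assumes i: "i \<in> {1..N - 1}" and inj: "inj_on z {1..N - 1}"
  shows "Q_Phi_trunc s N g i k z \<Xi> =
    (if active s k (z i) then acoef N g i z * partial2 i i (Phi (N - 1) i k) z * (norm (\<Xi> i))\<^sup>2 else 0)"
proof (cases "active s k (z i)")
  case False
  then show ?thesis
    using i by (simp add: Q_Phi_trunc_def Q_form_def Phi_trunc_hess_def partial_Phi_trunc_inactive)
next
  case True
  let ?\<Phi> = "Phi (N - 1) i k"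
  have "(\<Sum>j = 1..N - 1. acoef N g j z * partial2 j j ?\<Phi> z * (norm (\<Xi> j))\<^sup>2)
      = (\<Sum>j = 1..N - 1. if j = i then acoef N g i z * partial2 i i ?\<Phi> z * (norm (\<Xi> i))\<^sup>2 else 0)"
    using i by (intro sum.cong) (auto simp: partial2_Phi_offdiagonal)
  also have "\<dots> = acoef N g i z * partial2 i i ?\<Phi> z * (norm (\<Xi> i))\<^sup>2"
    using i by simp
  finally have diag: "(\<Sum>j = 1..N - 1. acoef N g j z * partial2 j j ?\<Phi> z * (norm (\<Xi> j))\<^sup>2)
      = acoef N g i z * partial2 i i ?\<Phi> z * (norm (\<Xi> i))\<^sup>2" .
  have off: "partial2 j l ?\<Phi> z + (partial j ?\<Phi> z - partial l ?\<Phi> z) / (z j - z l) = 0"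
    if "1 \<le> j" "j < l" "l \<le> N - 1" for j l
  proof -
    have "z j \<noteq> z l" using inj that by (auto dest: inj_onD)
    moreover have "(z l - z j) * partial2 j l ?\<Phi> z = partial j ?\<Phi> z - partial l ?\<Phi> z"
      using that i by (intro Euler_Poisson_Darboux_Phi) auto
    ultimately show ?thesis by (simp add: field_simps)
  qed
  have "(\<Sum>(j, l) \<in> {(j, l). 1 \<le> j \<and> j < l \<and> l \<le> N - 1}. (acoef N g j z + acoef N g l z)
        * (partial2 j l ?\<Phi> z + (partial j ?\<Phi> z - partial l ?\<Phi> z) / (z j - z l)) * (\<Xi> j \<bullet> \<Xi> l)) = 0"
    by (intro sum.neutral) (clarsimp simp: off simp del: One_nat_def)
  then show ?thesis
    using True diag
    by (simp add: Q_Phi_trunc_def Q_form_def Phi_trunc_hess_def partial_Phi_trunc_active)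
qed

section \<open>Sign and size of products of node distances\<close>

lemma sign_node_poly:
  assumes "i \<in> {1..m}" "\<And>j. 1 \<le> j \<Longrightarrow> j < i \<Longrightarrow> z j < s" "\<And>j. i < j \<Longrightarrow> j \<le> m \<Longrightarrow> s < z j"
  shows "(-1) ^ (i - 1) * node_poly ({1..m} - {i}) z s = (\<Prod>j\<in>{1..m} - {i}. \<bar>z j - s\<bar>)"
proof -
  have split: "{1..m} - {i} = {1..<i} \<union> {i<..m}" using assms(1) by auto
  \<comment> \<open>Exactly the \<open>i - 1\<close> nodes below \<open>s\<close> contribute a
    negative factor; this is the origin of the prefactor in \<open>Phi\<close>.\<close>
  have "(\<Prod>j=1..<i. z j - s) = (\<Prod>j=1..<i. (-1) * \<bar>z j - s\<bar>)"
    by (intro prod.cong) (use assms(2) in force)+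
  also have "\<dots> = (-1) ^ (i - 1) * (\<Prod>j=1..<i. \<bar>z j - s\<bar>)" unfolding prod.distrib by simp
  finally have 1: "(\<Prod>j=1..<i. z j - s) = (-1) ^ (i - 1) * (\<Prod>j=1..<i. \<bar>z j - s\<bar>)" .
  have 2: "(\<Prod>j\<in>{i<..m}. z j - s) = (\<Prod>j\<in>{i<..m}. \<bar>z j - s\<bar>)"
    by (intro prod.cong) (use assms(3) in force)+
  have union: "(\<Prod>j\<in>{1..<i} \<union> {i<..m}. f j) = (\<Prod>j=1..<i. f j) * (\<Prod>j\<in>{i<..m}. f j)" for f :: "nat \<Rightarrow> real"
    by (rule prod.union_disjoint) auto
  have sq: "(-1::real) ^ (i - 1) * (-1) ^ (i - 1) = 1" by (simp add: power_mult_distrib[symmetric])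
  show ?thesis
    unfolding node_poly_def split union 1 2 mult.assoc[symmetric] sq by simp
qed

text \<open>\<open>d \<le> 1 \<le> M\<close> allows one exponent \<open>m\<close> for products with
  fewer factors.\<close>

lemma prod_abs_bounds:
  fixes f :: "'a \<Rightarrow> real"
  assumes "finite A" "card A \<le> m" "0 \<le> d" "d \<le> 1" "1 \<le> M" "\<And>j. j \<in> A \<Longrightarrow> d \<le> \<bar>f j\<bar> \<and> \<bar>f j\<bar> \<le> M"
  shows "d ^ m \<le> (\<Prod>j\<in>A. \<bar>f j\<bar>)" "(\<Prod>j\<in>A. \<bar>f j\<bar>) \<le> M ^ m"
proof -
  have "d ^ m \<le> d ^ card A" using assms by (intro power_decreasing) auto
  also have "\<dots> = (\<Prod>j\<in>A. d)" by simp
  also have "\<dots> \<le> (\<Prod>j\<in>A. \<bar>f j\<bar>)" using assms by (intro prod_mono) auto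
  finally show "d ^ m \<le> (\<Prod>j\<in>A. \<bar>f j\<bar>)" .
  have "(\<Prod>j\<in>A. \<bar>f j\<bar>) \<le> (\<Prod>j\<in>A. M)" using assms by (intro prod_mono) auto
  also have "\<dots> = M ^ card A" by simp
  also have "\<dots> \<le> M ^ m" using assms by (intro power_increasing) auto
  finally show "(\<Prod>j\<in>A. \<bar>f j\<bar>) \<le> M ^ m" .
qed

subsection \<open>Constants on the box\<close>

locale interlacing_box =
  fixes N :: nat and g a b :: "nat \<Rightarrow> real"
  assumes N: "N \<ge> 2" and g1: "0 < g 1" and mono: "strict_mono_on {1..N} g"
    and ab: "\<forall>j \<in> {1..N - 1}. g j < a j \<and> a j \<le> b j \<and> b j < g (Suc j)"
begin

lemma g_mono: "1 \<le> j \<Longrightarrow> j \<le> l \<Longrightarrow> l \<le> N \<Longrightarrow> g j \<le> g l"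
  using strict_mono_on_leD[OF mono, of j l] by auto

lemma state_bounds:
  assumes "z \<in> state_box (N - 1) a b" "j \<in> {1..N - 1}"
  shows "a j \<le> z j" "z j \<le> b j" "0 < z j" "z j \<le> g (Suc j)" "z j \<le> g N"
proof -
  have z: "a j \<le> z j" "z j \<le> b j" using assms by (auto simp: state_box_def)
  moreover have "g j < a j" "b j < g (Suc j)" using ab assms(2) by auto
  moreover have "g 1 \<le> g j" "g (Suc j) \<le> g N" using assms(2) by (auto intro!: g_mono)
  ultimately show "a j \<le> z j" "z j \<le> b j" "0 < z j" "z j \<le> g (Suc j)" "z j \<le> g N" using g1 by linarith+
qed

text \<open>The number \<open>g l\<close> separates edge \<open>l\<close> from every earlier edge of
  the box. This orders the nodes and bounds their distances from below.\<close>

lemma endpoints_less: "1 \<le> j \<Longrightarrow> j < l \<Longrightarrow> l \<le> N - 1 \<Longrightarrow> b j < g l \<and> g l < a l"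
  using ab g_mono[of "Suc j" l] by force

lemma state_inj_on: "z \<in> state_box (N - 1) a b \<Longrightarrow> inj_on z {1..N - 1}"
proof (rule linorder_inj_onI)
  fix j l assume z: "z \<in> state_box (N - 1) a b" and jl: "j < l" "j \<in> {1..N - 1}" "l \<in> {1..N - 1}"
  show "z j \<noteq> z l"
    using state_bounds[OF z jl(2)] state_bounds[OF z jl(3)] endpoints_less[of j l] jl by auto
qed auto

text \<open>\<open>z l \<le> g (Suc l)\<close> on the box, so the subtracted states amount to at
  most the sum of \<open>g\<close> over \<open>{2..N}\<close> and \<open>g 1 > 0\<close> remains.
  Positivity of the states allows the omitted term to be restored in this estimate, and it gives the
  upper bound.\<close>

lemma lam_bounds:
  assumes z: "z \<in> state_box (N - 1) a b"
  shows "0 < lam N g i z" "lam N g i z \<le> (\<Sum>l = 1..N. g l)"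
proof -
  have "(\<Sum>l \<in> {1..N - 1} - {i}. z l) \<le> (\<Sum>l \<in> {1..N - 1}. z l)"
    using state_bounds(3)[OF z] by (intro sum_mono2) (auto intro: less_imp_le)
  also have "\<dots> \<le> (\<Sum>l = 1..N - 1. g (Suc l))"
    by (intro sum_mono state_bounds(4)[OF z])
  also have "\<dots> = (\<Sum>l = 2..N. g l)"
    using N sum.shift_bounds_cl_Suc_ivl[of g 1 "N - 1"] by (simp add: numeral_2_eq_2)
  also have "\<dots> < (\<Sum>l = 1..N. g l)"
    using N g1 by (subst (2) sum.atLeast_Suc_atMost) (auto simp: numeral_2_eq_2)
  finally show "0 < lam N g i z" by (simp add: lam_def)
  show "lam N g i z \<le> (\<Sum>l = 1..N. g l)"
  proof -
    have "0 \<le> (\<Sum>l \<in> {1..N - 1} - {i}. z l)"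
      by (rule sum_nonneg) (use state_bounds(3)[OF z] less_imp_le in auto)
    then show ?thesis by (simp add: lam_def)
  qed
qed

text \<open>For \<open>j < l\<close> one has \<open>b j < g l < a l\<close>, so the edges
  \<open>j\<close> and \<open>l\<close> are at least \<open>a l - g l\<close> apart. The cap 1 lets
  powers be compared for different numbers of factors.\<close>

definition gap :: real where
  "gap = Min (insert 1 ((\<lambda>j. a j - g j) ` {1..N - 1}))"

text \<open>States lie between 0 and \<open>g N\<close>, hence so do the absolute differences of two
  of them; the floor 1 is again for comparing powers.\<close>

definition diam :: real where
  "diam = max 1 (g N)"

lemma gap: "0 < gap" "gap \<le> 1" "j \<in> {1..N - 1} \<Longrightarrow> gap \<le> a j - g j"
proof -
  show "0 < gap" "gap \<le> 1" using ab by (auto simp: gap_def)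
  show "gap \<le> a j - g j" if "j \<in> {1..N - 1}"
    unfolding gap_def by (rule Min_le) (use that in auto)
qed

lemma node_distance:
  assumes z: "z \<in> state_box (N - 1) a b" and i: "i \<in> {1..N - 1}" and s: "s \<in> {a i..b i}" and j: "j \<in> {1..N - 1} - {i}"
  shows "gap \<le> \<bar>z j - s\<bar>" "\<bar>z j - s\<bar> \<le> diam"
proof -
  have j': "j \<in> {1..N - 1}" using j by simp
  note zj = state_bounds[OF z j']
  \<comment> \<open>With \<open>s\<close> as its \<open>i\<close>-th coordinate the state stays in
    the box, so the bounds for states apply to \<open>s\<close>.\<close>
  have "z(i := s) \<in> state_box (N - 1) a b" using z s by (auto simp: state_box_def)
  from state_bounds[OF this i] have si: "0 < s" "s \<le> g N" by simp_all
  show "\<bar>z j - s\<bar> \<le> diam" using zj si by (auto simp: diam_def)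
  show "gap \<le> \<bar>z j - s\<bar>"
  proof (cases "j < i")
    case True
    then show ?thesis using gap(3)[OF i] endpoints_less[of j i] i j zj s by auto
  next
    case False
    then show ?thesis using gap(3)[OF j'] endpoints_less[of i j] i j zj s by auto
  qed
qed

text \<open>\<open>A\<close> is free because the bounds are applied with node \<open>i\<close>
  deleted and also with a second node deleted.\<close>

lemma node_prod_bounds:
  assumes z: "z \<in> state_box (N - 1) a b" and i: "i \<in> {1..N - 1}" and s: "s \<in> {a i..b i}" and A: "A \<subseteq> {1..N - 1} - {i}"
  shows "gap ^ N \<le> (\<Prod>j\<in>A. \<bar>z j - s\<bar>)" "(\<Prod>j\<in>A. \<bar>z j - s\<bar>) \<le> diam ^ N"
proof -
  have 1: "finite A" using A by (rule finite_subset) simp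
  have 2: "card A \<le> N" using card_mono[of "{1..N - 1}" A] A by fastforce
  have 3: "1 \<le> diam" by (simp add: diam_def)
  have 4: "gap \<le> \<bar>z j - s\<bar> \<and> \<bar>z j - s\<bar> \<le> diam" if "j \<in> A" for j
    using node_distance[OF z i s] A that by blast
  show "gap ^ N \<le> (\<Prod>j\<in>A. \<bar>z j - s\<bar>)" "(\<Prod>j\<in>A. \<bar>z j - s\<bar>) \<le> diam ^ N"
    using prod_abs_bounds[OF 1 2 less_imp_le[OF gap(1)] gap(2) 3 4] by simp_all
qed

lemma truncation_constants_exist: "\<exists>c C. truncation_constants N g a b c C"
proof -
  define S where "S = (\<Sum>l = 1..N. g l)"
  define d where "d = gap ^ N"
  define C where "C = diam ^ N"
  \<comment> \<open>\<open>d / 2\<close> serves the lower bound of \<open>Phi\<close>, the half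
    coming from the integral of \<open>z i - \<sigma>\<close>, and the second derivative, which is
    at least \<open>d\<close>. \<open>d / S\<close> serves the coercivity, since \<open>lam\<close>
    is at most \<open>S\<close> on the box.\<close>
  define c where "c = min (d / 2) (d / S)"
  have d: "0 < d" "d \<le> 1" using gap by (auto simp: d_def power_le_one)
  have C: "1 \<le> C" by (simp add: C_def diam_def one_le_power)
  have S: "0 < S"
    unfolding S_def using g1 N g_mono[of 1] by (intro sum_pos) force+
  have "truncation_constants N g a b c C"
    unfolding truncation_constants_def Let_def
  proof (intro conjI ballI allI impI)
    show "0 < c" using d S by (simp add: c_def)
    show "c \<le> C" using d C by (simp add: c_def min_le_iff_disj)
    fix s i k z
    assume i: "i \<in> {1..N - 1}" and k: "k \<in> {a i..b i}" and z: "z \<in> state_box (N - 1) a b" and act: "active s k (z i)"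
    let ?r = "excess s k (z i)" and ?\<Phi> = "Phi (N - 1) i k"
    note r = abs_diff_active[OF act]
    have zi: "z i \<in> {a i..b i}" using state_bounds[OF z i] by simp
    \<comment> \<open>Both end points \<open>k\<close> and \<open>z i\<close> lie in the edge
      \<open>i\<close>, so the product bounds hold uniformly along the integration, in either
      orientation.\<close>
    have between: "\<sigma> \<in> {a i..b i}" if "\<sigma> \<in> {min k (z i)..max k (z i)}" for \<sigma>
      using that k zi by auto
    have sgn: "(-1) ^ (i - 1) * node_poly ({1..N - 1} - {i}) z \<sigma> = (\<Prod>j\<in>{1..N - 1} - {i}. \<bar>z j - \<sigma>\<bar>)"
      if \<sigma>: "\<sigma> \<in> {a i..b i}" for \<sigma>
    proof (rule sign_node_poly[OF i])
      show "z j < \<sigma>" if "1 \<le> j" "j < i" for j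
        using state_bounds(2)[OF z, of j] endpoints_less[of j i] i that \<sigma> by auto
      show "\<sigma> < z j" if "i < j" "j \<le> N - 1" for j
        using state_bounds(1)[OF z, of j] endpoints_less[of i j] i that \<sigma> by auto
    qed
    \<comment> \<open>The prefactor is moved under the integral, where it turns the node product
      into a positive weight.\<close>
    have \<Phi>: "Phi_trunc s (N - 1) i k z = (LBINT \<sigma>=ereal k..ereal (z i).
        (z i - \<sigma>) * ((-1) ^ (i - 1) * node_poly ({1..N - 1} - {i}) z \<sigma>))"
      using act by (simp add: Phi_trunc_def Phi_def node_poly_def mult.left_commute
          interval_lebesgue_integral_mult_right[symmetric] del: interval_lebesgue_integral_mult_right)
    have cont: "continuous_on UNIV (\<lambda>\<sigma>. (-1) ^ (i - 1) * node_poly ({1..N - 1} - {i}) z \<sigma>)"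
      by (intro continuous_intros continuous_on_node_poly)
    have w: "d \<le> (-1) ^ (i - 1) * node_poly ({1..N - 1} - {i}) z \<sigma> \<and>
        (-1) ^ (i - 1) * node_poly ({1..N - 1} - {i}) z \<sigma> \<le> C"
      if "\<sigma> \<in> {min k (z i)..max k (z i)}" for \<sigma>
      unfolding sgn[OF between[OF that]] d_def C_def
      using node_prod_bounds[OF z i between[OF that]] by blast
    have bounds: "d * ?r\<^sup>2 / 2 \<le> Phi_trunc s (N - 1) i k z" "Phi_trunc s (N - 1) i k z \<le> C * ?r\<^sup>2 / 2"
      unfolding \<Phi> r(2)
      by (rule interval_integral_linear_weight_bounds[OF cont]; rule w; assumption)+
    have "c \<le> d / 2" unfolding c_def by (rule min.cobounded1)
    then have "c * ?r\<^sup>2 \<le> d / 2 * ?r\<^sup>2" by (rule mult_right_mono) simp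
    then show "c * ?r\<^sup>2 \<le> Phi_trunc s (N - 1) i k z" using bounds(1) by simp
    have "C * ?r\<^sup>2 / 2 \<le> C * ?r\<^sup>2" using C by simp
    then show "Phi_trunc s (N - 1) i k z \<le> C * ?r\<^sup>2" using bounds(2) by linarith
    show "\<bar>partial i ?\<Phi> z\<bar> \<le> C * ?r"
    proof -
      have "\<bar>node_poly ({1..N - 1} - {i}) z \<sigma>\<bar> \<le> C" if "\<sigma> \<in> {min k (z i)..max k (z i)}" for \<sigma>
        using node_prod_bounds(2)[OF z i between[OF that] order_refl] by (simp add: node_poly_def abs_prod C_def)
      then have "\<bar>LBINT \<sigma>=ereal k..ereal (z i). node_poly ({1..N - 1} - {i}) z \<sigma>\<bar> \<le> C * \<bar>z i - k\<bar>"
        by (intro interval_integral_abs_le continuous_on_node_poly)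
      then show ?thesis
        using i r(1) by (simp add: partial_Phi Psi_def abs_mult power_abs)
    qed
    show "\<bar>partial j ?\<Phi> z\<bar> \<le> C * ?r\<^sup>2" if j: "j \<in> {1..N - 1} - {i}" for j
    proof -
      \<comment> \<open>For \<open>j \<noteq> i\<close> the node \<open>i\<close> is still present;
        its factor is at most the excess, and the length of the interval supplies the second
        power.\<close>
      have "\<bar>node_poly ({1..N - 1} - {j}) z \<sigma>\<bar> \<le> C * ?r" if \<sigma>: "\<sigma> \<in> {min k (z i)..max k (z i)}" for \<sigma>
      proof -
        have "\<bar>node_poly ({1..N - 1} - {j}) z \<sigma>\<bar> = \<bar>z i - \<sigma>\<bar> * (\<Prod>l\<in>{1..N - 1} - {j} - {i}. \<bar>z l - \<sigma>\<bar>)"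
          using i j by (subst node_poly_insert[of _ i]) (auto simp: abs_mult node_poly_def abs_prod)
        also have "\<dots> \<le> ?r * C"
        proof (rule mult_mono)
          show "\<bar>z i - \<sigma>\<bar> \<le> ?r" using \<sigma> r(1) by (auto simp: min_def max_def split: if_splits)
          show "(\<Prod>l\<in>{1..N - 1} - {j} - {i}. \<bar>z l - \<sigma>\<bar>) \<le> C"
            unfolding C_def by (rule node_prod_bounds(2)[OF z i between[OF \<sigma>]]) blast
          show "0 \<le> ?r" using r(1) by (metis abs_ge_zero)
        qed (intro prod_nonneg, simp)
        finally show ?thesis by (simp add: mult.commute)
      qed
      then have "\<bar>LBINT \<sigma>=ereal k..ereal (z i). node_poly ({1..N - 1} - {j}) z \<sigma>\<bar> \<le> C * ?r * \<bar>z i - k\<bar>"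
        by (intro interval_integral_abs_le continuous_on_node_poly)
      then show ?thesis
        using i j r(1) by (simp add: partial_Phi Psi_def abs_mult power_abs power2_eq_square mult.assoc)
    qed
    show diag: "partial2 i i ?\<Phi> z = (\<Prod>j\<in>{1..N - 1} - {i}. \<bar>z j - z i\<bar>)"
      using sgn[OF zi] i by (simp add: partial2_Phi_diagonal)
    have dd: "d \<le> partial2 i i ?\<Phi> z"
      unfolding diag d_def by (rule node_prod_bounds(1)[OF z i zi order_refl])
    then show "c \<le> partial2 i i ?\<Phi> z" using d by (simp add: c_def min_le_iff_disj)
    show "partial2 j j ?\<Phi> z = 0" if "j \<in> {1..N - 1} - {i}" for j
      using that i by (simp add: partial2_Phi_offdiagonal)
    show "(z \<beta> - z \<alpha>) * partial2 \<alpha> \<beta> ?\<Phi> z = partial \<alpha> ?\<Phi> z - partial \<beta> ?\<Phi> z"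
      if "\<alpha> \<in> {1..N - 1}" "\<beta> \<in> {1..N - 1}" "\<alpha> \<noteq> \<beta>" for \<alpha> \<beta>
      by (rule Euler_Poisson_Darboux_Phi[OF i that])
    have "d / S \<le> acoef N g i z * partial2 i i ?\<Phi> z"
    proof -
      \<comment> \<open>\<open>0 < lam \<le> S\<close> gives
        \<open>1 / S \<le> acoef\<close>.\<close>
      have "1 / S * d \<le> acoef N g i z * partial2 i i ?\<Phi> z"
        using lam_bounds[OF z, of i] S d dd
        by (intro mult_mono) (auto simp: acoef_def S_def intro!: divide_left_mono)
      then show ?thesis by simp
    qed
    then show "c \<le> acoef N g i z * partial2 i i ?\<Phi> z" by (simp add: c_def min_le_iff_disj)
  qed
  then show ?thesis by blast
qed

text \<open>By uniqueness an arbitrary \<open>Dr\<close> agrees almost everywhere with the explicit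
  gradient of the truncation; what remains is pointwise algebra at states in the box.\<close>

lemma Q_Phi_trunc_weak_gradient:
  fixes \<Omega> :: "'d::euclidean_space set" and z :: "'d \<Rightarrow> nat \<Rightarrow> real" and Dz :: "'d \<Rightarrow> nat \<Rightarrow> 'd"
  assumes const: "truncation_constants N g a b c C"
    and i: "i \<in> {1..N - 1}" and k: "k \<in> {a i..b i}" and \<Omega>: "open \<Omega>"
    and Dz: "has_weak_gradient \<Omega> (\<lambda>x. z x i) (\<lambda>x. Dz x i)"
    and box: "AE x\<in>\<Omega> in lebesgue. z x \<in> state_box (N - 1) a b"
    and Dr: "has_weak_gradient \<Omega> (\<lambda>x. excess s k (z x i)) Dr"
  shows "AE x\<in>\<Omega> in lebesgue.
      Q_Phi_trunc s N g i k (z x) (Dz x)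
        = acoef N g i (z x) * partial2 i i (Phi (N - 1) i k) (z x) * (norm (Dr x))\<^sup>2 \<and>
      acoef N g i (z x) * partial2 i i (Phi (N - 1) i k) (z x) * (norm (Dr x))\<^sup>2 \<ge> c * (norm (Dr x))\<^sup>2"
proof -
  have "AE x\<in>\<Omega> in lebesgue. Dr x = (if active s k (z x i) then side_sign s *\<^sub>R Dz x i else 0)"
    by (rule has_weak_gradient_unique[OF Dr has_weak_gradient_excess[OF Dz \<Omega>] \<Omega>])
  with box show ?thesis
  proof eventually_elim
    case (elim x)
    show ?case
    proof
      assume "x \<in> \<Omega>"
      with elim have zx: "z x \<in> state_box (N - 1) a b"
        and D: "Dr x = (if active s k (z x i) then side_sign s *\<^sub>R Dz x i else 0)" by blast+
      \<comment> \<open>The sign of the lower side disappears in the norm. Off the active side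
        \<open>Dr x\<close> and the quadratic form are both 0, so the claim holds there
        trivially.\<close>
      have "norm (Dr x) = (if active s k (z x i) then norm (Dz x i) else 0)"
        unfolding D by (cases s) auto
      then have "Q_Phi_trunc s N g i k (z x) (Dz x)
          = acoef N g i (z x) * partial2 i i (Phi (N - 1) i k) (z x) * (norm (Dr x))\<^sup>2"
        unfolding Q_Phi_trunc_eq[OF i state_inj_on[OF zx]] by simp
      moreover have "c * (norm (Dr x))\<^sup>2
          \<le> acoef N g i (z x) * partial2 i i (Phi (N - 1) i k) (z x) * (norm (Dr x))\<^sup>2"
      proof (cases "active s k (z x i)")
        case True
        then have "c \<le> acoef N g i (z x) * partial2 i i (Phi (N - 1) i k) (z x)"
          using const i k zx unfolding truncation_constants_def Let_def by blast
        then show ?thesis by (intro mult_right_mono) auto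
      qed (simp add: D)
      ultimately show "Q_Phi_trunc s N g i k (z x) (Dz x)
          = acoef N g i (z x) * partial2 i i (Phi (N - 1) i k) (z x) * (norm (Dr x))\<^sup>2 \<and>
        acoef N g i (z x) * partial2 i i (Phi (N - 1) i k) (z x) * (norm (Dr x))\<^sup>2 \<ge> c * (norm (Dr x))\<^sup>2"
        by blast
    qed
  qed
qed

end

text \<open>The coercivity is asserted for every admissible pair of constants, so the pair can be
  fixed independently of the type \<open>'d\<close>. Existence of \<open>Dr\<close> is stated
  separately, which keeps the claim about all \<open>Dr\<close> from being vacuous.\<close>

theorem lemma11p2:
  fixes N :: nat and g a b :: "nat \<Rightarrow> real"
  assumes "N \<ge> 2"
    and "0 < g 1" and "strict_mono_on {1..N} g"
    and "\<forall>j \<in> {1..N - 1}. g j < a j \<and> a j \<le> b j \<and> b j < g (Suc j)"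
  shows "(\<exists>c C. truncation_constants N g a b c C) \<and>
    (\<forall>c C. truncation_constants N g a b c C \<longrightarrow>
      (\<forall>s. \<forall>i \<in> {1..N - 1}. \<forall>k \<in> {a i..b i}.
       \<forall>(\<Omega> :: 'd::euclidean_space set) (z :: 'd \<Rightarrow> nat \<Rightarrow> real) (Dz :: 'd \<Rightarrow> nat \<Rightarrow> 'd).
         open \<Omega> \<and> (\<forall>j \<in> {1..N - 1}. has_weak_gradient \<Omega> (\<lambda>x. z x j) (\<lambda>x. Dz x j)) \<and>
         (AE x\<in>\<Omega> in lebesgue. z x \<in> state_box (N - 1) a b) \<longrightarrow>
         (\<exists>Dr. has_weak_gradient \<Omega> (\<lambda>x. excess s k (z x i)) Dr) \<and>
         (\<forall>Dr. has_weak_gradient \<Omega> (\<lambda>x. excess s k (z x i)) Dr \<longrightarrow>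
           (AE x\<in>\<Omega> in lebesgue.
              Q_Phi_trunc s N g i k (z x) (Dz x)
                = acoef N g i (z x) * partial2 i i (Phi (N - 1) i k) (z x) * (norm (Dr x))\<^sup>2 \<and>
              acoef N g i (z x) * partial2 i i (Phi (N - 1) i k) (z x) * (norm (Dr x))\<^sup>2
                \<ge> c * (norm (Dr x))\<^sup>2))))"
proof -
  interpret interlacing_box N g a b by unfold_locales (fact assms)+
  show ?thesis
  proof (intro conjI allI ballI impI; (elim conjE)?)
    show "\<exists>c C. truncation_constants N g a b c C" by (rule truncation_constants_exist)
  next
    fix s i k and \<Omega> :: "'d set" and z :: "'d \<Rightarrow> nat \<Rightarrow> real" and Dz :: "'d \<Rightarrow> nat \<Rightarrow> 'd"
    assume "i \<in> {1..N - 1}" "open \<Omega>" "\<forall>j \<in> {1..N - 1}. has_weak_gradient \<Omega> (\<lambda>x. z x j) (\<lambda>x. Dz x j)"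
    then show "\<exists>Dr. has_weak_gradient \<Omega> (\<lambda>x. excess s k (z x i)) Dr"
      using has_weak_gradient_excess by blast
  next
    fix c C s i k Dr and \<Omega> :: "'d set" and z :: "'d \<Rightarrow> nat \<Rightarrow> real" and Dz :: "'d \<Rightarrow> nat \<Rightarrow> 'd"
    assume A: "truncation_constants N g a b c C" "i \<in> {1..N - 1}" "k \<in> {a i..b i}" "open \<Omega>"
      and Dz: "\<forall>j \<in> {1..N - 1}. has_weak_gradient \<Omega> (\<lambda>x. z x j) (\<lambda>x. Dz x j)"
      and B: "AE x\<in>\<Omega> in lebesgue. z x \<in> state_box (N - 1) a b"
        "has_weak_gradient \<Omega> (\<lambda>x. excess s k (z x i)) Dr"
    show "AE x\<in>\<Omega> in lebesgue.
              Q_Phi_trunc s N g i k (z x) (Dz x)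
                = acoef N g i (z x) * partial2 i i (Phi (N - 1) i k) (z x) * (norm (Dr x))\<^sup>2 \<and>
              acoef N g i (z x) * partial2 i i (Phi (N - 1) i k) (z x) * (norm (Dr x))\<^sup>2
                \<ge> c * (norm (Dr x))\<^sup>2"
      by (rule Q_Phi_trunc_weak_gradient[where z = z and Dz = Dz and i = i, OF A bspec[OF Dz A(2)] B])
  qed
qed

end
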